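(* Let $G$ be a vertex decomposable graph. If there exists an independent set $A$ of $G$ such that $\mathcal{B}_{G\setminus N_G[A]}$ is not vertex decomposable, then for every $k\ge 2$ the ideal $J(G)^{(k)}$ is not componentwise linear.
   Context: Graphs are finite, simple, undirected. For $A\subseteq V(G)$, $N_G(A)$ is the set of vertices adjacent to some vertex of $A$, and $N_G[A]=N_G(A)\cup A$ (so $N_G[\emptyset]=\emptyset$; $A=\emptyset$ is allowed); $G\setminus U$ is the induced subgraph on $V(G)\setminus U$. Cover ideals. Let $V(G)=\{x_1,\dots,x_n\}$ and $R=\mathbb{K}[x_1,\dots,x_n]$, $\mathbb{K}$ a field. The cover ideal is $J(G)=\bigcap_{\{x_i,x_j\}\in E(G)}(x_i,x_j)$, and its $k$-th symbolic power is $J(G)^{(k)}=\bigcap_{\{x_i,x_j\}\in E(G)}(x_i,x_j)^k$. A homogeneous ideal $I$ is componentwise linear if for each $\ell$ the ideal generated by all degree $\ell$ elements of $I$ has a linear resolution. Vertex decomposability. A vertex $x$ of $G$ is a shedding vertex if no independent set of $G\setminus N_G[x]$ is a maximal independent set of $G\setminus x$. $G$ is (recursively) vertex decomposable if it has no edges, or it has a shedding vertex $x$ such that $G\setminus x$ and $G\setminus N_G[x]$ are both vertex decomposable. If $G$ is vertex decomposable, then so is $G\setminus N_G[A]$ for every independent set $A$ (known). The graph $\mathcal{B}_H$. Let $H$ be a vertex decomposable graph. A shedding order of $H$ is a sequence $(a_1,\dots,a_l)$ of vertices such that $a_1$ is a shedding vertex of $H$, $a_i$ is a shedding vertex of $H\setminus\{a_1,\dots,a_{i-1}\}$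 for $1<i\le l$, and $H\setminus\{a_1,\dots,a_l\}$ has no edges; the remaining vertices $\{b_1,\dots,b_r\}=V(H)\setminus\{a_1,\dots,a_l\}$ form the corresponding $i$-order. Given such a shedding order, $\mathcal{B}_H$ is the spanning bipartite subgraph of $H$ with vertex set $V(H)=\{b_1,\dots,b_r\}\sqcup\{a_1,\dots,a_l\}$ and edge set $\{\{b_i,a_j\}\in E(H): 1\le i\le r,\ 1\le j\le l\}$. For each vertex decomposable graph $H$ one (arbitrary) shedding order is fixed and $\mathcal{B}_H$ is formed from it. *)

theory Defs
  imports
    "HOL-Library.Poly_Mapping"
    "HOL-Algebra.Ideal_Product"
    "Jordan_Normal_Form.Matrix"
begin

section \<open>Graphs\<close>

record 'v ugraph =
  verts :: "'v set"
  edges :: "'v set set"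

definition simple_graph :: "'v ugraph \<Rightarrow> bool" where
  "simple_graph G \<longleftrightarrow> finite (verts G) \<and> (\<forall>e\<in>edges G. e \<subseteq> verts G \<and> card e = 2)"

definition nbhd :: "'v ugraph \<Rightarrow> 'v set \<Rightarrow> 'v set" where
  "nbhd G A = {y \<in> verts G. \<exists>x\<in>A. {x, y} \<in> edges G}"

definition closed_nbhd :: "'v ugraph \<Rightarrow> 'v set \<Rightarrow> 'v set" where
  "closed_nbhd G A = nbhd G A \<union> A"

definition del_verts :: "'v ugraph \<Rightarrow> 'v set \<Rightarrow> 'v ugraph" where
  "del_verts G U = \<lparr>verts = verts G - U, edges = {e \<in> edges G. e \<inter> U = {}}\<rparr>"

definition indep_set :: "'v ugraph \<Rightarrow> 'v set \<Rightarrow> bool" where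
  "indep_set G A \<longleftrightarrow> A \<subseteq> verts G \<and> (\<forall>e\<in>edges G. \<not> e \<subseteq> A)"

definition maximal_indep_set :: "'v ugraph \<Rightarrow> 'v set \<Rightarrow> bool" where
  "maximal_indep_set G A \<longleftrightarrow>
     indep_set G A \<and> (\<forall>B. indep_set G B \<and> A \<subseteq> B \<longrightarrow> B = A)"

definition shedding_vertex :: "'v ugraph \<Rightarrow> 'v \<Rightarrow> bool" where
  "shedding_vertex G x \<longleftrightarrow> x \<in> verts G \<and>
     \<not> (\<exists>A. indep_set (del_verts G (closed_nbhd G {x})) A \<and>
            maximal_indep_set (del_verts G {x}) A)"

inductive vertex_decomposable :: "'v ugraph \<Rightarrow> bool" where
  no_edges: "edges G = {} \<Longrightarrow> vertex_decomposable G"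
| shed: "shedding_vertex G x \<Longrightarrow> vertex_decomposable (del_verts G {x}) \<Longrightarrow>
    vertex_decomposable (del_verts G (closed_nbhd G {x})) \<Longrightarrow> vertex_decomposable G"

definition shedding_order :: "'v ugraph \<Rightarrow> 'v list \<Rightarrow> bool" where
  "shedding_order H as \<longleftrightarrow>
     (\<forall>i<length as. shedding_vertex (del_verts H (set (take i as))) (as ! i)) \<and>
     edges (del_verts H (set as)) = {}"

text \<open>The graph \<open>B_H\<close> of a shedding order \<open>as\<close> of \<open>H\<close>; the vertices outside \<open>set as\<close> are
  the corresponding i-order.\<close>

definition bip_graph :: "'v ugraph \<Rightarrow> 'v list \<Rightarrow> 'v ugraph" where
  "bip_graph H as =
     \<lparr>verts = verts H,
      edges = {{b, a} |b a. b \<in> verts H - set as \<and> a \<in> set as \<and> {b, a} \<in> edges H}\<rparr>"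

lemma simple_graph_del_verts: "simple_graph G \<Longrightarrow> simple_graph (del_verts G U)"
  by (auto simp: simple_graph_def del_verts_def)

lemma simple_graph_bip_graph: "simple_graph H \<Longrightarrow> simple_graph (bip_graph H as)"
  by (auto simp: simple_graph_def bip_graph_def)

lemma del_verts_empty: "del_verts G {} = G"
  by (cases G) (simp add: del_verts_def)

lemma del_verts_del_verts: "del_verts (del_verts G U) W = del_verts G (U \<union> W)"
  by (auto simp: del_verts_def)

lemma shedding_order_exists:
  assumes "vertex_decomposable H"
  shows "\<exists>as. shedding_order H as"
  using assms
proof (induction rule: vertex_decomposable.induct)
  case (no_edges G)
  then have "shedding_order G []"
    by (simp add: shedding_order_def del_verts_empty)
  then show ?case by blast
next
  case (shed G x)
  then obtain as where as: "shedding_order (del_verts G {x}) as" by blast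
  have "shedding_order G (x # as)"
    unfolding shedding_order_def
  proof (intro conjI allI impI)
    fix i assume "i < length (x # as)"
    then show "shedding_vertex (del_verts G (set (take i (x # as)))) ((x # as) ! i)"
      using as shed.hyps(1)
      by (cases i) (simp_all add: shedding_order_def del_verts_del_verts del_verts_empty)
  qed (use as in \<open>simp add: shedding_order_def del_verts_del_verts\<close>)
  then show ?case by blast
qed

section \<open>Polynomial rings and symbolic powers of cover ideals\<close>

text \<open>Monomials are finitely supported exponent functions; \<open>mpoly_ring V\<close> consists of the
  polynomials in the variables indexed by \<open>V\<close> only.\<close>

type_synonym ('v, 'k) mpol = "('v \<Rightarrow>\<^sub>0 nat) \<Rightarrow>\<^sub>0 'k"

definition mpoly_ring :: "'v set \<Rightarrow> ('v, 'k::field) mpol ring" where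
  "mpoly_ring V =
     \<lparr>carrier = {p. \<forall>m\<in>Poly_Mapping.keys p. Poly_Mapping.keys m \<subseteq> V},
      monoid.mult = (*), one = 1, zero = 0, add = (+)\<rparr>"

definition var :: "'v \<Rightarrow> ('v, 'k::field) mpol" where
  "var x = Poly_Mapping.single (Poly_Mapping.single x 1) 1"

lemma cring_mpoly_ring: "cring (mpoly_ring V :: ('v, 'k::field) mpol ring)"
proof (rule cringI)
  show "abelian_group (mpoly_ring V :: ('v, 'k) mpol ring)"
  proof (rule abelian_groupI)
    fix p q :: "('v, 'k) mpol"
    assume "p \<in> carrier (mpoly_ring V)" "q \<in> carrier (mpoly_ring V)"
    then show "p \<oplus>\<^bsub>mpoly_ring V\<^esub> q \<in> carrier (mpoly_ring V)"
      using Poly_Mapping.keys_add[of p q] by (auto simp: mpoly_ring_def)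
  next
    fix p :: "('v, 'k) mpol"
    assume "p \<in> carrier (mpoly_ring V)"
    then have "- p \<in> carrier (mpoly_ring V)"
      by (simp add: mpoly_ring_def)
    moreover have "(- p) \<oplus>\<^bsub>mpoly_ring V\<^esub> p = \<zero>\<^bsub>mpoly_ring V\<^esub>"
      by (simp add: mpoly_ring_def)
    ultimately show "\<exists>q\<in>carrier (mpoly_ring V). q \<oplus>\<^bsub>mpoly_ring V\<^esub> p = \<zero>\<^bsub>mpoly_ring V\<^esub>"
      by blast
  qed (simp_all add: mpoly_ring_def ac_simps)
next
  show "comm_monoid (mpoly_ring V :: ('v, 'k) mpol ring)"
  proof (rule comm_monoidI)
    fix p q :: "('v, 'k) mpol"
    assume p: "p \<in> carrier (mpoly_ring V)" and q: "q \<in> carrier (mpoly_ring V)"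
    have "Poly_Mapping.keys m \<subseteq> V" if m: "m \<in> Poly_Mapping.keys (p * q)" for m
    proof -
      obtain a b where "m = a + b" "a \<in> Poly_Mapping.keys p" "b \<in> Poly_Mapping.keys q"
        using m Poly_Mapping.keys_mult[of p q] by blast
      then show ?thesis
        using p q Poly_Mapping.keys_add[of a b] by (fastforce simp: mpoly_ring_def)
    qed
    then show "p \<otimes>\<^bsub>mpoly_ring V\<^esub> q \<in> carrier (mpoly_ring V)"
      by (simp add: mpoly_ring_def)
  qed (simp_all add: mpoly_ring_def ac_simps)
qed (simp add: mpoly_ring_def algebra_simps)

text \<open>For an edge \<open>e = {x, y}\<close> the ideal generated by \<open>var ` e\<close> is \<open>(x, y)\<close>, and its powers are
  powers in the monoid of ideals. The intersection with the carrier only matters for edgeless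
  graphs. The first symbolic power (\<open>k = 1\<close>) is the cover ideal itself.\<close>

definition cover_ideal_sympow :: "'v ugraph \<Rightarrow> nat \<Rightarrow> ('v, 'k::field) mpol set" where
  "cover_ideal_sympow G k =
     carrier (mpoly_ring (verts G)) \<inter>
     (\<Inter>e\<in>edges G. (Idl\<^bsub>mpoly_ring (verts G)\<^esub> (var ` e)) [^]\<^bsub>ideals_set (mpoly_ring (verts G))\<^esub> k)"

section \<open>Graded free resolutions and componentwise linearity\<close>

definition mdeg :: "('v \<Rightarrow>\<^sub>0 nat) \<Rightarrow> nat" where
  "mdeg m = (\<Sum>x\<in>Poly_Mapping.keys m. Poly_Mapping.lookup m x)"

definition homogeneous :: "nat \<Rightarrow> ('v, 'k::field) mpol \<Rightarrow> bool" where
  "homogeneous d p \<longleftrightarrow> (\<forall>m\<in>Poly_Mapping.keys p. mdeg m = d)"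

text \<open>\<open>free_mod V n\<close> is the free module \<open>R^n\<close> over \<open>R = mpoly_ring V\<close>.\<close>

definition free_mod :: "'v set \<Rightarrow> nat \<Rightarrow> ('v, 'k::field) mpol vec set" where
  "free_mod V n = {v \<in> carrier_vec n. \<forall>i<n. v $ i \<in> carrier (mpoly_ring V)}"

text \<open>A list \<open>t\<close> of degrees stands for the graded free module \<open>R(-t!0) \<oplus> R(-t!1) \<oplus> \<dots>\<close>.
  Degree-preserving maps from the module of \<open>t\<close> to the module of \<open>s\<close> are the matrices whose
  \<open>(i, j)\<close> entry is homogeneous of degree \<open>t!j - s!i\<close> (zero if this is negative).\<close>

definition graded_hom :: "'v set \<Rightarrow> nat list \<Rightarrow> nat list \<Rightarrow> ('v, 'k::field) mpol mat \<Rightarrow> bool" where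
  "graded_hom V s t M \<longleftrightarrow> M \<in> carrier_mat (length s) (length t) \<and>
     (\<forall>i<length s. \<forall>j<length t. M $$ (i, j) \<in> carrier (mpoly_ring V) \<and>
        (M $$ (i, j) = 0 \<or> s ! i \<le> t ! j \<and> homogeneous (t ! j - s ! i) (M $$ (i, j))))"

text \<open>A graded free resolution \<open>\<dots> \<rightarrow> F_1 \<rightarrow> F_0 \<rightarrow> I \<rightarrow> 0\<close>: the module \<open>F_i\<close> has the generator
  degrees \<open>s i\<close>, the matrix \<open>M 0\<close> is the augmentation \<open>F_0 \<rightarrow> R\<close> with image \<open>I\<close>, and
  \<open>M (Suc i)\<close> is the differential \<open>F_(i+1) \<rightarrow> F_i\<close>. Finite resolutions are those with
  \<open>s i = []\<close> for large \<open>i\<close>.\<close>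

definition graded_free_resolution ::
  "'v set \<Rightarrow> ('v, 'k::field) mpol set \<Rightarrow> (nat \<Rightarrow> nat list) \<Rightarrow> (nat \<Rightarrow> ('v, 'k) mpol mat) \<Rightarrow> bool" where
  "graded_free_resolution V I s M \<longleftrightarrow>
     graded_hom V [0] (s 0) (M 0) \<and>
     (\<forall>i. graded_hom V (s i) (s (Suc i)) (M (Suc i))) \<and>
     (\<lambda>v. (M 0 *\<^sub>v v) $ 0) ` free_mod V (length (s 0)) = I \<and>
     (\<forall>i. {v \<in> free_mod V (length (s i)). M i *\<^sub>v v = 0\<^sub>v (dim_row (M i))} =
          (\<lambda>w. M (Suc i) *\<^sub>v w) ` free_mod V (length (s (Suc i))))"

text \<open>Minimality: the entries of all differentials lie in the ideal generated by the variables,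
  i.e. have zero constant term.\<close>

definition minimal_graded_free_resolution ::
  "'v set \<Rightarrow> ('v, 'k::field) mpol set \<Rightarrow> (nat \<Rightarrow> nat list) \<Rightarrow> (nat \<Rightarrow> ('v, 'k) mpol mat) \<Rightarrow> bool" where
  "minimal_graded_free_resolution V I s M \<longleftrightarrow>
     graded_free_resolution V I s M \<and>
     (\<forall>i. \<forall>p<length (s i). \<forall>q<length (s (Suc i)).
        Poly_Mapping.lookup (M (Suc i) $$ (p, q)) 0 = 0)"

text \<open>Since minimal graded free resolutions are unique up to isomorphism, asking for some minimal
  resolution with \<open>F_i\<close> generated in degree \<open>d + i\<close> is a condition on the minimal resolution.
  The zero ideal, with all \<open>F_i = 0\<close>, has a linear resolution.\<close>

definition has_linear_resolution :: "'v set \<Rightarrow> ('v, 'k::field) mpol set \<Rightarrow> bool" where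
  "has_linear_resolution V I \<longleftrightarrow>
     (\<exists>d s M. minimal_graded_free_resolution V I s M \<and> (\<forall>i. \<forall>j\<in>set (s i). j = d + i))"

text \<open>Used for homogeneous ideals \<open>I\<close> of \<open>mpoly_ring V\<close> only; homogeneity is not part of the
  predicate, so its negation can never hold for the mere reason that \<open>I\<close> is not homogeneous.\<close>

definition componentwise_linear :: "'v set \<Rightarrow> ('v, 'k::field) mpol set \<Rightarrow> bool" where
  "componentwise_linear V I \<longleftrightarrow>
     (\<forall>l. has_linear_resolution V (Idl\<^bsub>mpoly_ring V\<^esub> {p \<in> I. homogeneous l p}))"

end

(* A graph that is not vertex decomposable contains, after deleting the closed neighbourhood of
   some independent set, a nonempty subgraph of minimum degree at least 2: a leaf makes its
   neighbour a shedding vertex, and both deletions are then again (up to an isolated vertex) of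
   the form G - N[z].  Applied to B_H this gives a bipartite core with sides L and R, where
   card L is at most card R.
   Vertex covers of B_H embed into the exponents of the k-th symbolic power because k is at least 2:
   vertices of the i-order get exponent 0 or 1, vertices of the shedding order k - 1 or k.
   Take the monomial u of the cover that contains R, and the monomial v of the cover that contains
   L, multiplied by a power of one variable in L so that the degrees agree.  A linear resolution
   would allow a first exchange step from u towards v, increasing one exponent in L and decreasing
   another one; since every vertex of the core has two neighbours in it, the result violates an edge. *)
theory Submission
  imports Defs
begin

section \<open>Vertex decomposable graphs\<close>

lemma verts_del_verts [simp]: "verts (del_verts G U) = verts G - U"
  by (simp add: del_verts_def)

lemma edges_del_verts_iff [simp]: "e \<in> edges (del_verts G U) \<longleftrightarrow> e \<in> edges G \<and> e \<inter> U = {}"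
  by (simp add: del_verts_def)

lemma simple_graph_edgeD:
  assumes "simple_graph G" "{x, y} \<in> edges G"
  shows "x \<in> verts G" "y \<in> verts G" "x \<noteq> y"
proof -
  have "{x, y} \<subseteq> verts G" "card {x, y} = 2"
    using assms unfolding simple_graph_def by blast+
  then show "x \<in> verts G" "y \<in> verts G" "x \<noteq> y"
    by auto
qed

lemma simple_graph_edgeE:
  assumes "simple_graph G" "e \<in> edges G"
  obtains x y where "e = {x, y}"
  using assms by (metis card_2_iff simple_graph_def)

lemma mem_closed_nbhd_single_iff:
  "y \<in> closed_nbhd G {x} \<longleftrightarrow> y = x \<or> y \<in> verts G \<and> {x, y} \<in> edges G"
  by (auto simp: closed_nbhd_def nbhd_def)

lemma indep_set_iff:
  assumes "simple_graph G"
  shows "indep_set G A \<longleftrightarrow> A \<subseteq> verts G \<and> (\<forall>x\<in>A. \<forall>y\<in>A. {x, y} \<notin> edges G)"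
proof (intro iffI conjI; (elim conjE)?)
  assume A: "A \<subseteq> verts G" "\<forall>x\<in>A. \<forall>y\<in>A. {x, y} \<notin> edges G"
  show "indep_set G A"
    unfolding indep_set_def
  proof (intro conjI ballI notI)
    fix e assume "e \<in> edges G" "e \<subseteq> A"
    moreover obtain x y where "e = {x, y}"
      using simple_graph_edgeE[OF assms \<open>e \<in> edges G\<close>] .
    ultimately show False
      using A(2) by auto
  qed (rule A)
qed (auto simp: indep_set_def)

lemma maximal_indep_set_iff:
  assumes "simple_graph G"
  shows "maximal_indep_set G A \<longleftrightarrow>
           indep_set G A \<and> (\<forall>y\<in>verts G - A. \<exists>x\<in>A. {x, y} \<in> edges G)" (is "?l \<longleftrightarrow> ?r")
proof
  assume l: ?l
  then have A: "indep_set G A"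
    by (simp add: maximal_indep_set_def)
  have "\<exists>x\<in>A. {x, y} \<in> edges G" if y: "y \<in> verts G - A" for y
  proof (rule ccontr)
    assume n: "\<not> ?thesis"
    have "{y, y} \<notin> edges G"
      using simple_graph_edgeD(3)[OF assms] by blast
    then have "indep_set G (insert y A)"
      using A n y unfolding indep_set_iff[OF assms] by (auto simp: insert_commute)
    then show False
      using l y unfolding maximal_indep_set_def by blast
  qed
  then show ?r
    using A by blast
next
  assume r: ?r
  have "B = A" if B: "indep_set G B" "A \<subseteq> B" for B
  proof (rule ccontr)
    assume "B \<noteq> A"
    then obtain y where "y \<in> B" "y \<notin> A"
      using B by blast
    then show False
      using r B unfolding indep_set_iff[OF assms] by blast
  qed
  then show ?l
    using r by (simp add: maximal_indep_set_def)
qed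

text \<open>Deleting vertices outside \<open>S\<close> changes no edge inside \<open>S\<close>, and
  an independent set that is not maximal can be enlarged by a single vertex \<open>y\<close>. The
  criterion is phrased in the edges of \<open>G\<close> alone, which lets later proofs move a test
  set \<open>S\<close> between \<open>G\<close> and its subgraphs.\<close>

lemma shedding_vertex_iff:
  assumes "simple_graph G"
  shows "shedding_vertex G x \<longleftrightarrow> x \<in> verts G \<and>
    (\<forall>S. S \<subseteq> verts G - closed_nbhd G {x} \<and> (\<forall>s\<in>S. \<forall>t\<in>S. {s, t} \<notin> edges G) \<longrightarrow>
      (\<exists>y\<in>verts G - {x} - S. \<forall>s\<in>S. {s, y} \<notin> edges G))"
proof -
  let ?M = "\<lambda>S. \<forall>y\<in>verts G - {x} - S. \<exists>s\<in>S. {s, y} \<in> edges G"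
  have *: "indep_set (del_verts G (closed_nbhd G {x})) S \<and> maximal_indep_set (del_verts G {x}) S
    \<longleftrightarrow> S \<subseteq> verts G - closed_nbhd G {x} \<and> (\<forall>s\<in>S. \<forall>t\<in>S. {s, t} \<notin> edges G) \<and> ?M S" for S
  proof (cases "S \<subseteq> verts G - closed_nbhd G {x}")
    case True
    then have x: "x \<notin> S" and N: "\<And>s. s \<in> S \<Longrightarrow> s \<notin> closed_nbhd G {x}"
      by (auto simp: mem_closed_nbhd_single_iff)
    have "{s, t} \<inter> closed_nbhd G {x} = {}" if "s \<in> S" "t \<in> S" for s t
      using N that by simp
    then have 1: "indep_set (del_verts G (closed_nbhd G {x})) S \<longleftrightarrow> (\<forall>s\<in>S. \<forall>t\<in>S. {s, t} \<notin> edges G)"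
      using True by (simp add: indep_set_iff[OF simple_graph_del_verts[OF assms]])
    have "{s, t} \<inter> {x} = {}" if "s \<in> S" "t \<noteq> x" for s t
      using x that by auto
    then have 2: "indep_set (del_verts G {x}) S \<longleftrightarrow> (\<forall>s\<in>S. \<forall>t\<in>S. {s, t} \<notin> edges G)"
      "(\<forall>y\<in>verts (del_verts G {x}) - S. \<exists>s\<in>S. {s, y} \<in> edges (del_verts G {x})) \<longleftrightarrow> ?M S"
      using True x by (auto simp: indep_set_iff[OF simple_graph_del_verts[OF assms]])
    show ?thesis
      unfolding 1 2 maximal_indep_set_iff[OF simple_graph_del_verts[OF assms]] using True by blast
  next
    case False
    then show ?thesis
      by (simp add: indep_set_iff[OF simple_graph_del_verts[OF assms]])
  qed
  have neg: "\<not> ?M S \<longleftrightarrow> (\<exists>y\<in>verts G - {x} - S. \<forall>s\<in>S. {s, y} \<notin> edges G)" for S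
    by simp
  show ?thesis
    unfolding shedding_vertex_def * neg[symmetric]
    by (simp only: not_ex de_Morgan_conj imp_conv_disj disj_assoc)
qed

section \<open>Deleting closed neighbourhoods of independent sets\<close>

text \<open>Neighbours of \<open>B\<close> that are lost in the smaller graph already lie in the
  closed neighbourhood of \<open>A\<close>. Successive deletions thus become a single one, and
  independent sets can be built vertex by vertex.\<close>

lemma closed_nbhd_Un:
  assumes "B \<inter> closed_nbhd G A = {}"
  shows "closed_nbhd G A \<union> closed_nbhd (del_verts G (closed_nbhd G A)) B = closed_nbhd G (A \<union> B)"
  using assms by (auto simp: closed_nbhd_def nbhd_def)

lemma del_verts_closed_nbhd_Un:
  assumes "B \<inter> closed_nbhd G A = {}"
  shows "del_verts (del_verts G (closed_nbhd G A)) (closed_nbhd (del_verts G (closed_nbhd G A)) B) =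
    del_verts G (closed_nbhd G (A \<union> B))"
  by (simp add: del_verts_del_verts closed_nbhd_Un[OF assms])

text \<open>Induction on the decomposition of \<open>G\<close>, comparing its shedding vertex
  \<open>x\<close> with \<open>v\<close>. If \<open>x\<close> lies outside the closed neighbourhood
  of \<open>v\<close>, it remains a shedding vertex after the deletion, and the deletions at
  \<open>x\<close> and \<open>v\<close> commute.\<close>

lemma vertex_decomposable_del_closed_nbhd_single:
  assumes "vertex_decomposable G" "simple_graph G" "v \<in> verts G"
  shows "vertex_decomposable (del_verts G (closed_nbhd G {v}))"
  using assms
proof (induction arbitrary: v rule: vertex_decomposable.induct)
  case (no_edges G)
  then show ?case
    by (intro vertex_decomposable.no_edges) (auto simp: del_verts_def)
next
  case (shed G x)
  note sg = \<open>simple_graph G\<close>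
  let ?N = "closed_nbhd G {v}"
  consider "v = x" | "v \<noteq> x" "x \<in> ?N" | "v \<noteq> x" "x \<notin> ?N"
    by blast
  then show ?case
  proof cases
    case 1
    then show ?thesis
      using shed by simp
  next
    case 2
    \<comment> \<open>A neighbour \<open>x\<close> of \<open>v\<close> is deleted anyway, so it may
      as well be deleted first.\<close>
    then have "del_verts (del_verts G {x}) (closed_nbhd (del_verts G {x}) {v}) = del_verts G ?N"
      unfolding del_verts_del_verts
      by (intro arg_cong[of _ _ "del_verts G"]) (auto simp: mem_closed_nbhd_single_iff)
    then show ?thesis
      using shed.IH(1)[OF simple_graph_del_verts[OF sg], of v] shed.prems 2 by simp
  next
    case 3
    then have vx: "v \<notin> closed_nbhd G {x}" "{x, v} \<notin> edges G" "{v, x} \<notin> edges G" "x \<in> verts G"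
      using shed.hyps(1) shed.prems
      by (auto simp: mem_closed_nbhd_single_iff shedding_vertex_def insert_commute)
    let ?G = "del_verts G ?N"
    have 1: "del_verts (del_verts G {x}) (closed_nbhd (del_verts G {x}) {v}) = del_verts ?G {x}"
      unfolding del_verts_del_verts
      using 3 by (intro arg_cong[of _ _ "del_verts G"]) (auto simp: mem_closed_nbhd_single_iff)
    have 2: "del_verts (del_verts G (closed_nbhd G {x}))
          (closed_nbhd (del_verts G (closed_nbhd G {x})) {v}) = del_verts ?G (closed_nbhd ?G {x})"
      using 3 vx by (subst (1 2) del_verts_closed_nbhd_Un) (auto simp: Un_commute)
    have "shedding_vertex ?G x"
      unfolding shedding_vertex_iff[OF simple_graph_del_verts[OF sg]]
    proof (intro conjI allI impI)
      fix S
      assume S: "S \<subseteq> verts ?G - closed_nbhd ?G {x} \<and> (\<forall>s\<in>S. \<forall>t\<in>S. {s, t} \<notin> edges ?G)"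
      then have SN: "s \<notin> ?N" if "s \<in> S" for s
        using that by auto
      have "{s, t} \<notin> edges G" if "s \<in> S" "t \<in> S" for s t
        using S SN that by auto
      moreover have "{s, v} \<notin> edges G" "{v, s} \<notin> edges G" "s \<in> verts G" "s \<notin> closed_nbhd G {x}"
        if "s \<in> S" for s
        using S SN[OF that] that 3 by (auto simp: mem_closed_nbhd_single_iff insert_commute)
      moreover have "{v, v} \<notin> edges G"
        using simple_graph_edgeD(3)[OF sg] by blast
      \<comment> \<open>\<open>insert v S\<close> is a test set in \<open>G\<close>; the vertex
        \<open>y\<close> obtained for it is neither equal nor adjacent to \<open>v\<close>, hence
        survives the deletion of \<open>?N\<close>.\<close>
      ultimately have "\<exists>y\<in>verts G - {x} - insert v S. \<forall>s\<in>insert v S. {s, y} \<notin> edges G"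
        using shed.hyps(1) vx shed.prems unfolding shedding_vertex_iff[OF sg]
        by (elim conjE allE[of _ "insert v S"]) auto
      then obtain y where "y \<in> verts G - {x} - insert v S" "\<forall>s\<in>insert v S. {s, y} \<notin> edges G"
        by blast
      then show "\<exists>y\<in>verts ?G - {x} - S. \<forall>s\<in>S. {s, y} \<notin> edges ?G"
        by (intro bexI[of _ y]) (auto simp: mem_closed_nbhd_single_iff)
    qed (use 3 vx in auto)
    then show ?thesis
      using shed.IH[OF simple_graph_del_verts[OF sg], of v] 1 2 3 vx shed.prems
      by (auto intro: vertex_decomposable.shed)
  qed
qed

lemma vertex_decomposable_del_closed_nbhd:
  assumes "vertex_decomposable G" "simple_graph G" "indep_set G A"
  shows "vertex_decomposable (del_verts G (closed_nbhd G A))"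
proof -
  have fin: "finite A"
    using assms by (auto simp: indep_set_def simple_graph_def intro: finite_subset)
  show ?thesis
    using fin assms(3)
  proof (induction A rule: finite_induct)
    case empty
    then show ?case
      using assms by (simp add: closed_nbhd_def nbhd_def del_verts_empty)
  next
    case (insert v A)
    have A: "indep_set G A" and v: "v \<in> verts G" "{v} \<inter> closed_nbhd G A = {}"
      using insert.prems insert.hyps
      unfolding indep_set_iff[OF assms(2)] by (auto simp: closed_nbhd_def nbhd_def)
    have "vertex_decomposable (del_verts (del_verts G (closed_nbhd G A))
            (closed_nbhd (del_verts G (closed_nbhd G A)) {v}))"
      using v insert.IH[OF A]
      by (intro vertex_decomposable_del_closed_nbhd_single simple_graph_del_verts[OF assms(2)]) auto
    then show ?case
      by (simp add: del_verts_closed_nbhd_Un[OF v(2)])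
  qed
qed

section \<open>Reduction to minimum degree at least two\<close>

text \<open>An isolated vertex lies in no closed neighbourhood but its own and blocks no extension
  of a test set, so the decomposition of the smaller graph carries over to \<open>G\<close>.\<close>

lemma vertex_decomposable_add_isolated:
  assumes "vertex_decomposable (del_verts G {z})" "simple_graph G" "\<And>e. e \<in> edges G \<Longrightarrow> z \<notin> e"
  shows "vertex_decomposable G"
proof -
  have "vertex_decomposable G"
    if "vertex_decomposable G'" "G' = del_verts G {z}" "simple_graph G"
      "\<And>e. e \<in> edges G \<Longrightarrow> z \<notin> e" for G' G :: "'a ugraph"
    using that
  proof (induction arbitrary: G rule: vertex_decomposable.induct)
    case (no_edges G')
    then have "edges G = {}"
      using edges_del_verts_iff[of _ G "{z}"] by (metis disjoint_insert(2) empty_iff inf_bot_right subsetI subset_empty)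
    then show ?case
      by (rule vertex_decomposable.no_edges)
  next
    case (shed G' x)
    note sg = \<open>simple_graph G\<close>
    have x: "x \<in> verts G" "x \<noteq> z"
      using shed.hyps(1) shed.prems by (auto simp: shedding_vertex_def)
    have N: "closed_nbhd G' {x} = closed_nbhd G {x}"
      using shed.prems(1,3) x by (force simp: mem_closed_nbhd_single_iff)
    have "shedding_vertex G x"
      unfolding shedding_vertex_iff[OF sg]
    proof (intro conjI allI impI)
      fix S
      assume S: "S \<subseteq> verts G - closed_nbhd G {x} \<and> (\<forall>s\<in>S. \<forall>t\<in>S. {s, t} \<notin> edges G)"
      then have "\<exists>y\<in>verts G' - {x} - (S - {z}). \<forall>s\<in>S - {z}. {s, y} \<notin> edges G'"
        using shed.hyps(1) shed.prems(1) N sg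
        by (elim shedding_vertex_iff[THEN iffD1, THEN conjunct2, rule_format, rotated])
          (auto intro: simple_graph_del_verts)
      then show "\<exists>y\<in>verts G - {x} - S. \<forall>s\<in>S. {s, y} \<notin> edges G"
        using shed.prems(1,3) by fastforce
    qed (rule x)
    moreover have "vertex_decomposable (del_verts G {x})"
      using shed.prems x
      by (intro shed.IH(1) simple_graph_del_verts[OF sg])
        (auto simp: del_verts_del_verts insert_commute)
    moreover have "vertex_decomposable (del_verts G (closed_nbhd G {x}))"
      using shed.prems x N
      by (intro shed.IH(2) simple_graph_del_verts[OF sg]) (auto simp: del_verts_del_verts)
    ultimately show ?case
      by (rule vertex_decomposable.shed)
  qed
  then show ?thesis
    using assms by blast
qed

text \<open>If \<open>x\<close> is isolated, \<open>z = x\<close> works. If \<open>i\<close> is its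
  only neighbour, every independent set avoiding the closed neighbourhood of \<open>i\<close> can be
  extended by \<open>x\<close>, so \<open>i\<close> is a shedding vertex and one of its two
  deletions fails. Either \<open>z = i\<close> works, or removing \<open>i\<close> isolates
  \<open>x\<close> and \<open>z = x\<close> works.\<close>

lemma not_vertex_decomposable_leaf_or_isolated:
  assumes "simple_graph G" "\<not> vertex_decomposable G" "x \<in> verts G"
    and i: "\<And>p. {x, p} \<in> edges G \<Longrightarrow> p = i"
  obtains z where "z \<in> verts G" "\<not> vertex_decomposable (del_verts G (closed_nbhd G {z}))"
proof (cases "{x, i} \<in> edges G")
  case False
  then have xp: "{x, p} \<notin> edges G" for p
    using i by blast
  then have "closed_nbhd G {x} = {x}"
    by (auto simp: mem_closed_nbhd_single_iff)
  moreover have "x \<notin> e" if e: "e \<in> edges G" for e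
  proof
    assume "x \<in> e"
    moreover obtain y z where "e = {y, z}"
      using simple_graph_edgeE[OF assms(1) e] .
    ultimately show False
      using e xp[of y] xp[of z] by (auto simp: insert_commute)
  qed
  ultimately show ?thesis
    using vertex_decomposable_add_isolated[of G x] assms(1-3) that[of x] by auto
next
  case True
  note xi = simple_graph_edgeD[OF assms(1) True]
  have xp: "{x, p} \<in> edges G \<longleftrightarrow> p = i" for p
    using True i by blast
  have N: "closed_nbhd G {x} = {i, x}"
    using xi by (auto simp: mem_closed_nbhd_single_iff xp)
  have "shedding_vertex G i"
    unfolding shedding_vertex_iff[OF assms(1)]
  proof (intro conjI allI impI)
    fix S
    assume S: "S \<subseteq> verts G - closed_nbhd G {i} \<and> (\<forall>s\<in>S. \<forall>t\<in>S. {s, t} \<notin> edges G)"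
    then show "\<exists>y\<in>verts G - {i} - S. \<forall>s\<in>S. {s, y} \<notin> edges G"
      using xi
      by (intro bexI[of _ x]) (auto simp: mem_closed_nbhd_single_iff insert_commute[of _ x] xp)
  qed (rule xi)
  then consider "\<not> vertex_decomposable (del_verts G {i})"
    | "\<not> vertex_decomposable (del_verts G (closed_nbhd G {i}))"
    using assms(2) vertex_decomposable.shed[of G i] by blast
  then show ?thesis
  proof cases
    case 1
    have "x \<notin> e" if e: "e \<in> edges (del_verts G {i})" for e
    proof
      assume "x \<in> e"
      have "e \<in> edges G" "i \<notin> e"
        using e by auto
      moreover obtain y z where "e = {y, z}"
        using simple_graph_edgeE[OF assms(1) \<open>e \<in> edges G\<close>] .
      ultimately show False
        using xp[of y] xp[of z] \<open>x \<in> e\<close> by (auto simp: insert_commute)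
    qed
    then have "\<not> vertex_decomposable (del_verts (del_verts G {i}) {x})"
      using 1 vertex_decomposable_add_isolated[of "del_verts G {i}" x]
        simple_graph_del_verts[OF assms(1), of "{i}"] by argo
    then show ?thesis
      using that[of x] assms(3) by (simp add: del_verts_del_verts N insert_commute)
  next
    case 2
    then show ?thesis
      using that[of i] xi by blast
  qed
qed

text \<open>Vertices of degree at most 1 are eliminated by
  \<open>not_vertex_decomposable_leaf_or_isolated\<close>, and the vertices \<open>z\<close> it
  yields are collected in \<open>C\<close>. A neighbour other than \<open>i\<close>, for every
  \<open>i\<close>, amounts to two distinct neighbours; in this form the exchange argument can avoid
  the vertex whose exponent was raised.\<close>

lemma not_vertex_decomposable_min_degree_ge_2:
  assumes "simple_graph G" "\<not> vertex_decomposable G"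
  obtains C where "indep_set G C" "verts G - closed_nbhd G C \<noteq> {}"
    "\<And>x i. x \<in> verts G - closed_nbhd G C \<Longrightarrow>
       \<exists>p. p \<in> verts G - closed_nbhd G C \<and> p \<noteq> i \<and> {x, p} \<in> edges G"
proof -
  have "\<exists>C. indep_set G C \<and> verts G - closed_nbhd G C \<noteq> {} \<and>
    (\<forall>x\<in>verts G - closed_nbhd G C. \<forall>i.
       \<exists>p. p \<in> verts G - closed_nbhd G C \<and> p \<noteq> i \<and> {x, p} \<in> edges G)"
    using assms
  proof (induction "card (verts G)" arbitrary: G rule: less_induct)
    case less
    note sg = less.prems(1)
    show ?case
    proof (cases "\<forall>x\<in>verts G. \<forall>i. \<exists>p. p \<noteq> i \<and> {x, p} \<in> edges G")
      case True
      have "edges G \<noteq> {}"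
        using less.prems vertex_decomposable.no_edges by blast
      then have "verts G \<noteq> {}"
        using sg by (metis ex_in_conv simple_graph_edgeD(1) simple_graph_edgeE)
      moreover have "\<exists>p. p \<in> verts G \<and> p \<noteq> i \<and> {x, p} \<in> edges G" if "x \<in> verts G" for x i
        using True that simple_graph_edgeD(2)[OF sg] by meson
      moreover have "closed_nbhd G {} = {}" "indep_set G {}"
        by (simp_all add: indep_set_iff[OF sg] closed_nbhd_def nbhd_def)
      ultimately show ?thesis
        by (intro exI[of _ "{}"]) simp
    next
      case False
      then obtain x i where "x \<in> verts G" "\<And>p. {x, p} \<in> edges G \<Longrightarrow> p = i"
        by blast
      then obtain z where z: "z \<in> verts G" "\<not> vertex_decomposable (del_verts G (closed_nbhd G {z}))"
        using not_vertex_decomposable_leaf_or_isolated[OF less.prems] by metis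
      let ?G = "del_verts G (closed_nbhd G {z})"
      have "card (verts ?G) < card (verts G)"
        using sg z by (intro psubset_card_mono) (auto simp: simple_graph_def mem_closed_nbhd_single_iff)
      then obtain C where C: "indep_set ?G C" "verts ?G - closed_nbhd ?G C \<noteq> {}"
        "\<forall>x\<in>verts ?G - closed_nbhd ?G C. \<forall>i.
           \<exists>p. p \<in> verts ?G - closed_nbhd ?G C \<and> p \<noteq> i \<and> {x, p} \<in> edges ?G"
        using less.hyps[OF _ simple_graph_del_verts[OF sg] z(2)] by blast
      have C': "C \<subseteq> verts G - closed_nbhd G {z}" "\<forall>x\<in>C. \<forall>y\<in>C. {x, y} \<notin> edges G"
        using C(1) unfolding indep_set_iff[OF simple_graph_del_verts[OF sg]] by auto
      then have "closed_nbhd G {z} \<union> closed_nbhd ?G C = closed_nbhd G (insert z C)"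
        by (subst closed_nbhd_Un) auto
      then have *: "verts ?G - closed_nbhd ?G C = verts G - closed_nbhd G (insert z C)"
        by auto
      have "{z, z} \<notin> edges G"
        using simple_graph_edgeD(3)[OF sg] by blast
      then have "indep_set G (insert z C)"
        using C' z(1) unfolding indep_set_iff[OF sg]
        by (auto simp: mem_closed_nbhd_single_iff insert_commute)
      then show ?thesis
        using C(2,3) unfolding * by (intro exI[of _ "insert z C"]) auto
    qed
  qed
  then show ?thesis
    using that by blast
qed

text \<open>Otherwise consider the last \<open>a\<close> without neighbour in the i-order: the i-order is an
  independent set avoiding the neighbours of \<open>a\<close>, so the shedding property yields a later vertex
  without neighbour in the i-order.\<close>

lemma shedding_order_neighbour:
  assumes sg: "simple_graph H" and as: "shedding_order H as" and a: "a \<in> set as"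
  shows "\<exists>b\<in>verts H - set as. {b, a} \<in> edges H"
proof (rule ccontr)
  let ?B = "verts H - set as"
  define P where "P i \<longleftrightarrow> i < length as \<and> (\<forall>b\<in>?B. {b, as ! i} \<notin> edges H)" for i
  assume "\<not> ?thesis"
  then have ex: "\<exists>i. P i"
    using a by (auto simp: P_def in_set_conv_nth)
  have bd: "\<forall>i. P i \<longrightarrow> i \<le> length as"
    by (auto simp: P_def)
  define i where "i = (GREATEST i. P i)"
  have Pi: "P i"
    unfolding i_def using GreatestI_ex_nat[OF ex] bd by blast
  have le: "j \<le> i" if "P j" for j
    unfolding i_def using Greatest_le_nat[where P = P, OF that] bd by blast
  let ?K = "del_verts H (set (take i as))"
  have tk: "set (take i as) \<subseteq> set as"
    by (rule set_take_subset)
  have ai: "as ! i \<in> set as"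
    using Pi by (simp add: P_def)
  have indep: "{s, t} \<notin> edges H" if "s \<in> ?B" "t \<in> ?B" for s t
  proof
    assume "{s, t} \<in> edges H"
    then have "{s, t} \<in> edges (del_verts H (set as))"
      using that by auto
    moreover have "edges (del_verts H (set as)) = {}"
      using as by (simp add: shedding_order_def)
    ultimately show False
      by blast
  qed
  have "shedding_vertex ?K (as ! i)"
    using as Pi by (auto simp: shedding_order_def P_def)
  moreover have "?B \<subseteq> verts ?K - closed_nbhd ?K {as ! i}"
    using tk ai Pi by (auto simp: mem_closed_nbhd_single_iff P_def insert_commute)
  ultimately obtain y where y: "y \<in> verts ?K - {as ! i} - ?B" "\<forall>s\<in>?B. {s, y} \<notin> edges ?K"
    using indep unfolding shedding_vertex_iff[OF simple_graph_del_verts[OF sg]]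
    by (metis edges_del_verts_iff)
  \<comment> \<open>Outside the i-order, \<open>y\<close> belongs to the shedding order. Neither
    \<open>y\<close> nor \<open>?B\<close> meets \<open>set (take i as)\<close>, so \<open>y\<close>
    has no neighbour in \<open>?B\<close> in \<open>H\<close> either, and its index is greater than
    \<open>i\<close>.\<close>
  then obtain j where j: "j < length as" "y = as ! j"
    by (auto simp: in_set_conv_nth)
  have "P j"
    using y j tk by (auto simp: P_def)
  then have "j \<le> i"
    by (rule le)
  moreover have "j \<noteq> i"
    using y j by auto
  ultimately have "y \<in> set (take i as)"
    using j by (auto simp: in_set_conv_nth intro!: exI[of _ j])
  then show False
    using y by auto
qed

section \<open>Monomials and linear syzygies\<close>

lemma mdeg_eq_sum:
  assumes "finite S" "Poly_Mapping.keys m \<subseteq> S"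
  shows "mdeg m = (\<Sum>x\<in>S. Poly_Mapping.lookup m x)"
  unfolding mdeg_def using assms by (intro sum.mono_neutral_left) (auto simp: in_keys_iff)

lemma mdeg_add: "mdeg (m + n) = mdeg m + mdeg n"
proof -
  let ?S = "Poly_Mapping.keys m \<union> Poly_Mapping.keys n"
  have "mdeg k = (\<Sum>x\<in>?S. Poly_Mapping.lookup k x)" if "k \<in> {m, n, m + n}" for k
    using that Poly_Mapping.keys_add[of m n] by (intro mdeg_eq_sum) auto
  then show ?thesis
    by (simp add: lookup_add sum.distrib)
qed

lemma mdeg_eq_0_iff: "mdeg m = 0 \<longleftrightarrow> m = 0"
  by (auto simp: mdeg_def in_keys_iff intro!: poly_mapping_eqI)

lemma mdeg_single [simp]: "mdeg (Poly_Mapping.single i c) = c"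
  by (simp add: mdeg_def)

lemma single_add_diff:
  fixes m :: "'v \<Rightarrow>\<^sub>0 nat"
  assumes "i \<in> Poly_Mapping.keys m"
  shows "Poly_Mapping.single i 1 + (m - Poly_Mapping.single i 1) = m"
  using assms
  by (intro poly_mapping_eqI) (auto simp: lookup_add lookup_minus lookup_single when_def in_keys_iff)

lemma mdeg_eq_1D:
  assumes "mdeg m = 1"
  obtains i where "m = Poly_Mapping.single i 1"
proof -
  obtain i where i: "i \<in> Poly_Mapping.keys m"
    using assms by (fastforce simp: mdeg_def)
  have "mdeg (m - Poly_Mapping.single i 1) = 0"
    using mdeg_add[of "Poly_Mapping.single i 1" "m - Poly_Mapping.single i 1"] assms
    unfolding single_add_diff[OF i] by simp
  then have "m = Poly_Mapping.single i 1"
    using single_add_diff[OF i] by (simp add: mdeg_eq_0_iff)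
  then show ?thesis
    by (rule that)
qed

section \<open>Coefficients of products\<close>

text \<open>Existence of \<open>b\<close> says that the monomial \<open>a\<close> divides
  \<open>m\<close>; only then is the truncated difference \<open>m - a\<close> the true
  cofactor.\<close>

lemma lookup_mult_eq_sum:
  fixes p q :: "('v, 'k::field) mpol"
  shows "Poly_Mapping.lookup (p * q) m =
    (\<Sum>a\<in>Poly_Mapping.keys p. if \<exists>b. m = a + b
       then Poly_Mapping.lookup p a * Poly_Mapping.lookup q (m - a) else 0)"
proof -
  have "(\<Sum>b. Poly_Mapping.lookup q b when m = a + b) =
      (if \<exists>b. m = a + b then Poly_Mapping.lookup q (m - a) else 0)" for a
  proof (cases "\<exists>b. m = a + b")
    case True
    then obtain b where b: "m = a + b" by blast
    have "(\<Sum>b'. Poly_Mapping.lookup q b' when m = a + b') = (\<Sum>b'. Poly_Mapping.lookup q b' when b' = b)"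
      by (simp add: b eq_commute)
    then show ?thesis
      using b by simp
  qed simp
  then have "Poly_Mapping.lookup (p * q) m = (\<Sum>a. Poly_Mapping.lookup p a *
      (if \<exists>b. m = a + b then Poly_Mapping.lookup q (m - a) else 0))"
    by (simp add: lookup_mult)
  also have "\<dots> = (\<Sum>a\<in>Poly_Mapping.keys p. Poly_Mapping.lookup p a *
      (if \<exists>b. m = a + b then Poly_Mapping.lookup q (m - a) else 0))"
    by (rule Sum_any.expand_superset) (auto simp: in_keys_iff)
  finally show ?thesis
    by (simp add: if_distrib cong: if_cong)
qed

lemma lookup_mult_single:
  fixes p :: "('v, 'k::field) mpol"
  shows "Poly_Mapping.lookup (p * Poly_Mapping.single 0 c) m = Poly_Mapping.lookup p m * c"
  by (cases "c = 0") (simp_all add: mult.commute[of p] lookup_mult_eq_sum)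

text \<open>If \<open>m = a + b\<close> with \<open>a\<close> of the same degree as
  \<open>m\<close>, then \<open>b\<close> is 0, so only the constant term of \<open>q\<close>
  contributes.\<close>

lemma lookup_mult_homogeneous:
  fixes p q :: "('v, 'k::field) mpol"
  assumes "homogeneous l p" "mdeg m = l"
  shows "Poly_Mapping.lookup (p * q) m = Poly_Mapping.lookup p m * Poly_Mapping.lookup q 0"
proof -
  have "a = m" if "a \<in> Poly_Mapping.keys p" "m = a + b" for a b
    using that assms mdeg_add[of a b] by (auto simp: homogeneous_def mdeg_eq_0_iff)
  then have "Poly_Mapping.lookup (p * q) m = (\<Sum>a\<in>Poly_Mapping.keys p.
      if a = m then Poly_Mapping.lookup p m * Poly_Mapping.lookup q 0 else 0)"
    unfolding lookup_mult_eq_sum by (intro sum.cong) (auto intro: exI[of _ 0])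
  then show ?thesis
    by (simp add: in_keys_iff)
qed

text \<open>The monomials of a linear form are single variables, and a variable divides
  \<open>m\<close> exactly if it is among the keys of \<open>m\<close>.\<close>

lemma lookup_mult_homogeneous_1:
  fixes p q :: "('v, 'k::field) mpol"
  assumes "homogeneous 1 p"
  shows "Poly_Mapping.lookup (p * q) m = (\<Sum>i\<in>Poly_Mapping.keys m.
    Poly_Mapping.lookup p (Poly_Mapping.single i 1) *
    Poly_Mapping.lookup q (m - Poly_Mapping.single i 1))"
proof -
  let ?S = "(\<lambda>i. Poly_Mapping.single i (1::nat)) ` Poly_Mapping.keys m"
  let ?t = "\<lambda>a. Poly_Mapping.lookup p a * Poly_Mapping.lookup q (m - a)"
  have inj: "inj (\<lambda>i::'v. Poly_Mapping.single i (1::nat))"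
  proof (rule injI)
    fix i j :: 'v assume "Poly_Mapping.single i (1::nat) = Poly_Mapping.single j 1"
    then have "Poly_Mapping.lookup (Poly_Mapping.single i (1::nat)) j = 1"
      by simp
    then show "i = j"
      by (simp add: lookup_single when_def split: if_splits)
  qed
  have iff: "(\<exists>b. m = a + b) \<longleftrightarrow> a \<in> ?S" if "a \<in> Poly_Mapping.keys p" for a
  proof -
    have "mdeg a = 1"
      using assms that unfolding homogeneous_def by blast
    then obtain i where a: "a = Poly_Mapping.single i 1"
      by (rule mdeg_eq_1D)
    have "(\<exists>b. m = a + b) \<longleftrightarrow> i \<in> Poly_Mapping.keys m"
    proof
      assume "i \<in> Poly_Mapping.keys m"
      then show "\<exists>b. m = a + b"
        unfolding a by (intro exI) (rule single_add_diff[symmetric])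
    qed (auto simp: a in_keys_iff lookup_add)
    moreover have "a \<in> ?S \<longleftrightarrow> i \<in> Poly_Mapping.keys m"
      unfolding a using inj by (rule inj_image_mem_iff)
    ultimately show ?thesis
      by simp
  qed
  have "Poly_Mapping.lookup (p * q) m = (\<Sum>a\<in>Poly_Mapping.keys p. if a \<in> ?S then ?t a else 0)"
    unfolding lookup_mult_eq_sum by (intro sum.cong) (simp_all add: iff)
  also have "\<dots> = (\<Sum>a\<in>Poly_Mapping.keys p \<inter> ?S. ?t a)"
    by (simp add: sum.inter_restrict)
  also have "\<dots> = (\<Sum>a\<in>?S. ?t a)"
    by (intro sum.mono_neutral_left) (auto simp: in_keys_iff)
  also have "\<dots> = (\<Sum>i\<in>Poly_Mapping.keys m. ?t (Poly_Mapping.single i 1))"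
    by (subst sum.reindex[OF inj_on_subset[OF inj subset_UNIV]]) (simp add: o_def)
  finally show ?thesis .
qed

section \<open>Monomial ideals and powers of edge ideals\<close>

text \<open>Every monomial of a product \<open>a * p\<close> is a multiple of a monomial of
  \<open>p\<close>, so an upward closed condition on exponents cuts out an ideal. It bounds from
  above both the powers of edge ideals and the ideal generated by one graded component.\<close>

lemma ideal_upset:
  fixes V :: "'v set"
  assumes Q: "\<And>m n. Q m \<Longrightarrow> Q (m + n)"
  shows "ideal {p \<in> carrier (mpoly_ring V). \<forall>m\<in>Poly_Mapping.keys p. Q m}
           (mpoly_ring V :: ('v, 'k::field) mpol ring)" (is "ideal ?I ?R")
proof -
  interpret cring ?R
    by (rule cring_mpoly_ring)
  have mult: "a \<otimes>\<^bsub>?R\<^esub> p \<in> ?I" if a: "a \<in> carrier ?R" and p: "p \<in> ?I" for a p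
  proof -
    have "Q m" if m: "m \<in> Poly_Mapping.keys (a * p)" for m
    proof -
      obtain b c where "m = b + c" "b \<in> Poly_Mapping.keys a" "c \<in> Poly_Mapping.keys p"
        using m Poly_Mapping.keys_mult[of a p] by blast
      then show ?thesis
        using p Q[of c b] by (simp add: add.commute)
    qed
    moreover have "a \<otimes>\<^bsub>?R\<^esub> p = a * p"
      by (simp add: mpoly_ring_def)
    moreover have "a \<otimes>\<^bsub>?R\<^esub> p \<in> carrier ?R"
      using a p by simp
    ultimately show ?thesis
      by simp
  qed
  show ?thesis
  proof (rule idealI)
    show "subgroup ?I (add_monoid ?R)"
    proof (rule add.subgroupI)
      show "?I \<noteq> {}"
        by (auto intro!: exI[of _ "0 :: ('v, 'k) mpol"] simp: mpoly_ring_def)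
    next
      fix p assume p: "p \<in> ?I"
      then have "\<ominus>\<^bsub>?R\<^esub> p = (\<ominus>\<^bsub>?R\<^esub> \<one>\<^bsub>?R\<^esub>) \<otimes>\<^bsub>?R\<^esub> p"
        by (simp add: l_minus)
      then show "\<ominus>\<^bsub>?R\<^esub> p \<in> ?I"
        using mult[of "\<ominus>\<^bsub>?R\<^esub> \<one>\<^bsub>?R\<^esub>" p] p by simp
    next
      fix p q assume "p \<in> ?I" "q \<in> ?I"
      moreover from this have "p \<oplus>\<^bsub>?R\<^esub> q \<in> carrier ?R"
        by simp
      moreover have "p \<oplus>\<^bsub>?R\<^esub> q = p + q"
        by (simp add: mpoly_ring_def)
      ultimately show "p \<oplus>\<^bsub>?R\<^esub> q \<in> ?I"
        using Poly_Mapping.keys_add[of p q] by auto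
    qed auto
  next
    fix p a assume p: "p \<in> ?I" and a: "a \<in> carrier ?R"
    show "a \<otimes>\<^bsub>?R\<^esub> p \<in> ?I"
      by (rule mult[OF a p])
    moreover have "p \<otimes>\<^bsub>?R\<^esub> a = a \<otimes>\<^bsub>?R\<^esub> p"
      using p a by (simp add: m_comm)
    ultimately show "p \<otimes>\<^bsub>?R\<^esub> a \<in> ?I"
      by simp
  qed (rule ring_axioms)
qed

lemma single_in_carrier_iff:
  "(Poly_Mapping.single m 1 :: ('v, 'k::field) mpol) \<in> carrier (mpoly_ring V) \<longleftrightarrow>
     Poly_Mapping.keys m \<subseteq> V"
  by (simp add: mpoly_ring_def)

lemma ideals_set_pow_0: "I [^]\<^bsub>ideals_set R\<^esub> (0::nat) = carrier R"
  by (simp add: nat_pow_def ideals_set_def)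

lemma ideals_set_pow_Suc:
  "I [^]\<^bsub>ideals_set R\<^esub> Suc k = ideal_prod R (I [^]\<^bsub>ideals_set R\<^esub> k) I"
  by (simp add: nat_pow_def ideals_set_def)

text \<open>The exponent sum at \<open>x\<close> and \<open>y\<close> is additive under products of
  monomials and at least 1 on the monomials occurring in the edge ideal; induction on
  \<open>k\<close> gives the bound.\<close>

lemma edge_ideal_pow_subset:
  fixes p :: "('v, 'k::field) mpol"
  assumes "x \<in> V" "y \<in> V"
    and "p \<in> (Idl\<^bsub>mpoly_ring V\<^esub> (var ` {x, y})) [^]\<^bsub>ideals_set (mpoly_ring V)\<^esub> k"
  shows "p \<in> carrier (mpoly_ring V)"
    "\<forall>m\<in>Poly_Mapping.keys p. k \<le> Poly_Mapping.lookup m x + Poly_Mapping.lookup m y"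
proof -
  let ?R = "mpoly_ring V :: ('v, 'k) mpol ring"
  let ?P = "Idl\<^bsub>?R\<^esub> (var ` {x, y})"
  let ?J = "\<lambda>k. {p \<in> carrier ?R. \<forall>m\<in>Poly_Mapping.keys p.
      k \<le> Poly_Mapping.lookup m x + Poly_Mapping.lookup m y}"
  interpret cring ?R
    by (rule cring_mpoly_ring)
  have ideal: "ideal (?J k) ?R" for k
    by (rule ideal_upset) (simp add: lookup_add)
  have P: "?P \<subseteq> ?J 1"
    using assms(1,2)
    by (intro genideal_minimal ideal) (auto simp: var_def single_in_carrier_iff lookup_single)
  have "?P [^]\<^bsub>ideals_set ?R\<^esub> k \<subseteq> ?J k"
  proof (induction k)
    case 0
    then show ?case
      unfolding ideals_set_pow_0 by simp
  next
    case (Suc k)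
    show ?case
    proof
      fix p assume "p \<in> ?P [^]\<^bsub>ideals_set ?R\<^esub> Suc k"
      then have "p \<in> ideal_prod ?R (?P [^]\<^bsub>ideals_set ?R\<^esub> k) ?P"
        by (simp only: ideals_set_pow_Suc)
      then show "p \<in> ?J (Suc k)"
      proof (induction rule: ideal_prod.induct)
        case (prod a b)
        then have a: "a \<in> ?J k" and b: "b \<in> ?J 1"
          using Suc P by blast+
        have "Suc k \<le> Poly_Mapping.lookup m x + Poly_Mapping.lookup m y"
          if m: "m \<in> Poly_Mapping.keys (a * b)" for m
        proof -
          obtain s t where "m = s + t" "s \<in> Poly_Mapping.keys a" "t \<in> Poly_Mapping.keys b"
            using m Poly_Mapping.keys_mult[of a b] by blast
          then show ?thesis
            using a b by (fastforce simp: lookup_add)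
        qed
        moreover have "a \<otimes>\<^bsub>?R\<^esub> b = a * b"
          by (simp add: mpoly_ring_def)
        moreover have "a \<otimes>\<^bsub>?R\<^esub> b \<in> carrier ?R"
          using a b by simp
        ultimately show ?case
          by simp
      next
        case (sum a b)
        then show ?case
          using additive_subgroup.a_closed[OF ideal.axioms(1)[OF ideal[of "Suc k"]]] by blast
      qed
    qed
  qed
  then show "p \<in> carrier ?R"
    "\<forall>m\<in>Poly_Mapping.keys p. k \<le> Poly_Mapping.lookup m x + Poly_Mapping.lookup m y"
    using assms(3) by auto
qed

text \<open>Splits off a variable \<open>z\<close> of the edge that divides the monomial. As
  \<open>x\<close> and \<open>y\<close> differ, this lowers the exponent sum by exactly 1.\<close>

lemma single_in_edge_ideal_pow:
  assumes "x \<in> V" "y \<in> V" "x \<noteq> y" "Poly_Mapping.keys m \<subseteq> V"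
    and "k \<le> Poly_Mapping.lookup m x + Poly_Mapping.lookup m y"
  shows "(Poly_Mapping.single m 1 :: ('v, 'k::field) mpol) \<in>
    (Idl\<^bsub>mpoly_ring V\<^esub> (var ` {x, y})) [^]\<^bsub>ideals_set (mpoly_ring V)\<^esub> k"
proof -
  let ?R = "mpoly_ring V :: ('v, 'k) mpol ring"
  let ?P = "Idl\<^bsub>?R\<^esub> (var ` {x, y})"
  interpret cring ?R
    by (rule cring_mpoly_ring)
  have P: "var ` {x, y} \<subseteq> ?P"
    using assms(1,2) by (intro genideal_self) (auto simp: var_def single_in_carrier_iff)
  show ?thesis
    using assms(4,5)
  proof (induction k arbitrary: m)
    case 0
    then show ?case
      unfolding ideals_set_pow_0 single_in_carrier_iff by simp
  next
    case (Suc k)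
    then obtain z where z: "z \<in> {x, y}" "z \<in> Poly_Mapping.keys m"
      by (metis add_is_0 in_keys_iff insertCI le_zero_eq nat.distinct(1))
    let ?m = "m - Poly_Mapping.single z 1"
    have m: "Poly_Mapping.lookup m w = Poly_Mapping.lookup ?m w + (if z = w then 1 else 0)" for w
      using z(2) by (auto simp: lookup_minus lookup_single when_def in_keys_iff)
    have "Poly_Mapping.keys ?m \<subseteq> Poly_Mapping.keys m"
      by (auto simp: in_keys_iff lookup_minus)
    moreover have "k \<le> Poly_Mapping.lookup ?m x + Poly_Mapping.lookup ?m y"
      using Suc.prems(2) z(1) assms(3) m[of x] m[of y] by (auto split: if_splits)
    ultimately have "Poly_Mapping.single ?m 1 \<in> ?P [^]\<^bsub>ideals_set ?R\<^esub> k"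
      using Suc.prems(1) by (intro Suc.IH) auto
    moreover have "var z \<in> ?P"
      using z(1) P by blast
    ultimately have "Poly_Mapping.single ?m 1 \<otimes>\<^bsub>?R\<^esub> var z \<in> ?P [^]\<^bsub>ideals_set ?R\<^esub> Suc k"
      unfolding ideals_set_pow_Suc by (rule ideal_prod.prod)
    moreover have "Poly_Mapping.single ?m 1 \<otimes>\<^bsub>?R\<^esub> var z = Poly_Mapping.single m 1"
      using single_add_diff[OF z(2)] by (simp add: mpoly_ring_def var_def mult_single add.commute)
    ultimately show ?case
      by simp
  qed
qed

text \<open>Only generation of the first syzygies in degree \<open>d + 1\<close> is used. Lifting \<open>x\<^sup>u\<close> and \<open>x\<^sup>v\<close> to the
  free module and applying the coefficient functional \<open>[x\<^sup>u]\<close> of the generators to the syzygy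
  \<open>x\<^sup>r x\<^sup>u - x\<^sup>t x\<^sup>v = 0\<close>, where \<open>r = v - u\<close> and \<open>t = u - v\<close> (truncated), gives \<open>x\<^sup>r\<close> up to other
  monomials; if no exchange is possible, the functional kills the coefficients of
  the linear syzygies at the variables in \<open>r\<close>.\<close>

lemma linear_resolution_exchange:
  fixes K :: "('v, 'k::field) mpol set"
  assumes lin: "has_linear_resolution V K"
    and K: "\<And>p m. p \<in> K \<Longrightarrow> m \<in> Poly_Mapping.keys p \<Longrightarrow> l \<le> mdeg m \<and> P m"
    and u: "Poly_Mapping.single u 1 \<in> K" "mdeg u = l" "Poly_Mapping.keys u \<subseteq> V"
    and v: "Poly_Mapping.single v 1 \<in> K" "mdeg v = l" "Poly_Mapping.keys v \<subseteq> V"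
    and "u \<noteq> v"
  shows "\<exists>i j. i \<noteq> j \<and> Poly_Mapping.lookup u i < Poly_Mapping.lookup v i \<and>
    0 < Poly_Mapping.lookup u j \<and> P (u + Poly_Mapping.single i 1 - Poly_Mapping.single j 1)"
proof (rule ccontr)
  assume exch: "\<not> ?thesis"
  then have noex: "\<not> P (u + Poly_Mapping.single i 1 - Poly_Mapping.single j 1)"
    if "i \<noteq> j" "Poly_Mapping.lookup u i < Poly_Mapping.lookup v i" "0 < Poly_Mapping.lookup u j" for i j
    using that exch by blast
  obtain d s M where res: "graded_free_resolution V K s M"
    and deg: "\<And>i j. j \<in> set (s i) \<Longrightarrow> j = d + i"
    using lin unfolding has_linear_resolution_def minimal_graded_free_resolution_def by blast
  define n0 where "n0 = length (s 0)"
  define n1 where "n1 = length (s 1)"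
  define f where "f p = M 0 $$ (0, p)" for p
  define N where "N p q = M 1 $$ (p, q)" for p q
  have M0: "M 0 \<in> carrier_mat 1 n0" and M1: "M 1 \<in> carrier_mat n0 n1"
    and f_hom: "\<And>p. p < n0 \<Longrightarrow> homogeneous d (f p)"
    and N_hom: "\<And>p q. p < n0 \<Longrightarrow> q < n1 \<Longrightarrow> homogeneous 1 (N p q)"
  proof -
    have g0: "graded_hom V [0] (s 0) (M 0)" and g1: "graded_hom V (s 0) (s (Suc 0)) (M (Suc 0))"
      using res unfolding graded_free_resolution_def by blast+
    show "M 0 \<in> carrier_mat 1 n0" "M 1 \<in> carrier_mat n0 n1"
      using g0 g1 by (simp_all add: graded_hom_def n0_def n1_def)
    show "homogeneous d (f p)" if "p < n0" for p
      using g0 that deg[of "s 0 ! p" 0]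
      by (auto simp: graded_hom_def n0_def f_def homogeneous_def)
    show "homogeneous 1 (N p q)" if "p < n0" "q < n1" for p q
      using g1 that deg[of "s 0 ! p" 0] deg[of "s 1 ! q" 1]
      by (fastforce simp: graded_hom_def n0_def n1_def N_def homogeneous_def)
  qed
  have M0v: "(M 0 *\<^sub>v w) $ 0 = (\<Sum>p<n0. f p * w $ p)" if "w \<in> carrier_vec n0" for w
    using M0 that by (auto simp: scalar_prod_def f_def atLeast0LessThan intro!: sum.cong)
  have M1v: "(M 1 *\<^sub>v w) $ p = (\<Sum>q<n1. N p q * w $ q)" if "w \<in> carrier_vec n1" "p < n0" for w p
    using M1 that by (auto simp: scalar_prod_def N_def atLeast0LessThan intro!: sum.cong)
  have image: "K = (\<lambda>w. (M 0 *\<^sub>v w) $ 0) ` free_mod V n0"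
    using res by (simp add: graded_free_resolution_def n0_def)
  have kernel: "{w \<in> free_mod V n0. M 0 *\<^sub>v w = 0\<^sub>v 1} = (\<lambda>w. M 1 *\<^sub>v w) ` free_mod V n1"
  proof -
    have "{v \<in> free_mod V (length (s 0)). M 0 *\<^sub>v v = 0\<^sub>v (dim_row (M 0))} =
        (\<lambda>w. M (Suc 0) *\<^sub>v w) ` free_mod V (length (s (Suc 0)))"
      using res unfolding graded_free_resolution_def by blast
    then show ?thesis
      using M0 by (simp add: n0_def n1_def)
  qed
  have unit: "unit_vec n p \<in> free_mod V n" for n p
    by (auto simp: free_mod_def mpoly_ring_def unit_vec_def)
  have f_K: "f p \<in> K" if p: "p < n0" for p
  proof -
    have "(M 0 *\<^sub>v unit_vec n0 p) $ 0 = f p"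
      using p by (subst M0v) (simp_all add: if_distrib[of "(*) _"] cong: if_cong)
    then show ?thesis
      using unit[of n0 p] unfolding image by (metis imageI)
  qed
  have f_supp: "Poly_Mapping.lookup (f p) m = 0" if "p < n0" "\<not> P m" for p m
    using K[OF f_K[OF that(1)]] that(2) by (auto simp: in_keys_iff)
  have lift: "\<exists>w. w \<in> free_mod V n0 \<and> Poly_Mapping.single m 1 = (\<Sum>p<n0. f p * w $ p)"
    if "Poly_Mapping.single m 1 \<in> K" for m
    using that M0v unfolding image by (auto simp: free_mod_def)
  \<comment> \<open>Some generator has a monomial \<open>a\<close> dividing the monomial of
    \<open>u\<close>. Its degree \<open>d\<close> is at most \<open>l\<close> by divisibility and at
    least \<open>l\<close> by the bound on \<open>K\<close>.\<close>
  have "d = l"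
  proof -
    obtain w where w: "Poly_Mapping.single u 1 = (\<Sum>p<n0. f p * w $ p)"
      using lift[OF u(1)] by blast
    have "Poly_Mapping.lookup (Poly_Mapping.single u (1::'k)) u \<noteq> 0"
      by simp
    then have "(\<Sum>p<n0. Poly_Mapping.lookup (f p * w $ p) u) \<noteq> 0"
      unfolding w lookup_sum .
    then obtain p where p: "p < n0" "Poly_Mapping.lookup (f p * w $ p) u \<noteq> 0"
      by (meson lessThan_iff sum.neutral)
    then obtain a b where ab: "u = a + b" "a \<in> Poly_Mapping.keys (f p)"
      using Poly_Mapping.keys_mult[of "f p" "w $ p"] by (fastforce simp: in_keys_iff)
    then have "mdeg a = d" "l \<le> mdeg a"
      using f_hom[OF p(1)] K[OF f_K[OF p(1)]] by (auto simp: homogeneous_def)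
    then show ?thesis
      using ab(1) u(2) mdeg_add[of a b] by simp
  qed
  \<comment> \<open>Generators and monomial have the same degree, so constant coefficients suffice:
    in degree \<open>l\<close> only the constant terms of \<open>w\<close> contribute, and in every
    other degree both sides vanish.\<close>
  have lift_const: "\<exists>\<alpha>. \<forall>m'. (\<Sum>p<n0. Poly_Mapping.lookup (f p) m' * \<alpha> p) =
      Poly_Mapping.lookup (Poly_Mapping.single m 1) m'"
    if m: "Poly_Mapping.single m 1 \<in> K" "mdeg m = l" for m
  proof -
    obtain w where w: "Poly_Mapping.single m 1 = (\<Sum>p<n0. f p * w $ p)"
      using lift[OF m(1)] by blast
    have "(\<Sum>p<n0. Poly_Mapping.lookup (f p) m' * Poly_Mapping.lookup (w $ p) 0) =
        Poly_Mapping.lookup (Poly_Mapping.single m 1) m'" for m'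
    proof (cases "mdeg m' = l")
      case True
      then have "Poly_Mapping.lookup (f p * w $ p) m' =
          Poly_Mapping.lookup (f p) m' * Poly_Mapping.lookup (w $ p) 0" if "p < n0" for p
        using f_hom[OF that] \<open>d = l\<close> by (intro lookup_mult_homogeneous) auto
      then show ?thesis
        unfolding w lookup_sum by (intro sum.cong) auto
    next
      case False
      then have "Poly_Mapping.lookup (f p) m' = 0" if "p < n0" for p
        using f_hom[OF that] \<open>d = l\<close> by (auto simp: homogeneous_def in_keys_iff)
      moreover have "m \<noteq> m'"
        using False m(2) by blast
      ultimately show ?thesis
        by (simp add: lookup_single_not_eq)
    qed
    then show ?thesis
      by (intro exI[of _ "\<lambda>p. Poly_Mapping.lookup (w $ p) 0"]) simp
  qed
  obtain \<alpha> where \<alpha>: "\<And>m. (\<Sum>p<n0. Poly_Mapping.lookup (f p) m * \<alpha> p) =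
      Poly_Mapping.lookup (Poly_Mapping.single u 1) m"
    using lift_const[OF u(1,2)] by blast
  obtain \<beta> where \<beta>: "\<And>m. (\<Sum>p<n0. Poly_Mapping.lookup (f p) m * \<beta> p) =
      Poly_Mapping.lookup (Poly_Mapping.single v 1) m"
    using lift_const[OF v(1,2)] by blast
  define r where "r = v - u"
  define t where "t = u - v"
  have rt: "r + u = t + v"
    by (intro poly_mapping_eqI) (simp add: r_def t_def lookup_add lookup_minus)
  have keys_rt: "Poly_Mapping.keys r \<subseteq> V" "Poly_Mapping.keys t \<subseteq> V"
    using u(3) v(3) by (auto simp: r_def t_def in_keys_iff lookup_minus)
  \<comment> \<open>The lifts of the monomials of \<open>u\<close> and \<open>v\<close>, multiplied
    by those of \<open>r\<close> and \<open>t\<close>, have the same image because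
    \<open>r + u = t + v\<close>; their difference \<open>z\<close> is a syzygy.\<close>
  define z where "z = vec n0 (\<lambda>p. Poly_Mapping.single r (\<alpha> p) - Poly_Mapping.single t (\<beta> p))"
  have scale: "(\<Sum>p<n0. f p * Poly_Mapping.single m' (\<gamma> p)) = Poly_Mapping.single m' 1 * Poly_Mapping.single m 1"
    if "\<And>m'. (\<Sum>p<n0. Poly_Mapping.lookup (f p) m' * \<gamma> p) =
      Poly_Mapping.lookup (Poly_Mapping.single m 1) m'" for \<gamma> m m'
  proof -
    have "f p * Poly_Mapping.single m' (\<gamma> p) = Poly_Mapping.single m' 1 * (f p * Poly_Mapping.single 0 (\<gamma> p))" for p
      by (metis add.right_neutral mult.left_commute mult_1 mult_single)
    then have "(\<Sum>p<n0. f p * Poly_Mapping.single m' (\<gamma> p)) =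
        Poly_Mapping.single m' 1 * (\<Sum>p<n0. f p * Poly_Mapping.single 0 (\<gamma> p))"
      by (simp add: sum_distrib_left)
    moreover have "(\<Sum>p<n0. f p * Poly_Mapping.single 0 (\<gamma> p)) = Poly_Mapping.single m 1"
      by (intro poly_mapping_eqI) (simp add: lookup_sum lookup_mult_single that)
    ultimately show ?thesis
      by simp
  qed
  have z_mod: "z \<in> free_mod V n0"
  proof -
    have "Poly_Mapping.keys (Poly_Mapping.single r a - Poly_Mapping.single t b) \<subseteq> {r, t}" for a b :: 'k
      by (auto simp: in_keys_iff lookup_minus lookup_single when_def split: if_splits)
    then show ?thesis
      using keys_rt by (fastforce simp: free_mod_def z_def mpoly_ring_def)
  qed
  have "(M 0 *\<^sub>v z) $ 0 = (\<Sum>p<n0. f p * Poly_Mapping.single r (\<alpha> p)) -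
      (\<Sum>p<n0. f p * Poly_Mapping.single t (\<beta> p))"
    by (subst M0v) (simp_all add: z_def right_diff_distrib sum_subtractf)
  also have "\<dots> = 0"
    unfolding scale[OF \<alpha>] scale[OF \<beta>] by (simp add: mult_single rt)
  finally have "M 0 *\<^sub>v z = 0\<^sub>v 1"
    using M0 by (intro eq_vecI) auto
  then have "z \<in> (\<lambda>w. M 1 *\<^sub>v w) ` free_mod V n1"
    unfolding kernel[symmetric] using z_mod by simp
  then obtain w where w: "w \<in> carrier_vec n1" "z = M 1 *\<^sub>v w"
    by (auto simp: free_mod_def)
  \<comment> \<open>The \<alpha> part contributes 1. The \<beta> part contributes 0 even if
    \<open>t = r\<close>, since the monomial of \<open>v\<close> has coefficient 0 at
    \<open>u\<close>.\<close>
  have "(\<Sum>p<n0. Poly_Mapping.lookup (f p) u * Poly_Mapping.lookup (z $ p) r) = 1"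
  proof -
    have "(\<Sum>p<n0. Poly_Mapping.lookup (f p) u * Poly_Mapping.lookup (z $ p) r) =
        (\<Sum>p<n0. Poly_Mapping.lookup (f p) u * \<alpha> p) -
        (if t = r then (\<Sum>p<n0. Poly_Mapping.lookup (f p) u * \<beta> p) else 0)"
      by (simp add: z_def lookup_minus lookup_single right_diff_distrib sum_subtractf)
    then show ?thesis
      using \<open>u \<noteq> v\<close> by (simp add: \<alpha> \<beta> lookup_single)
  qed
  moreover have "(\<Sum>p<n0. Poly_Mapping.lookup (f p) u * Poly_Mapping.lookup (z $ p) r) = 0"
  proof -
    let ?c = "\<lambda>p q i. Poly_Mapping.lookup (N p q) (Poly_Mapping.single i 1)"
    \<comment> \<open>Compare coefficients at \<open>u + Poly_Mapping.single i 1\<close> in the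
      relation given by column \<open>q\<close>: a nonzero term at some other \<open>j\<close> would
      be an exchange excluded by \<open>noex\<close>.\<close>
    have H: "(\<Sum>p<n0. Poly_Mapping.lookup (f p) u * ?c p q i) = 0"
      if q: "q < n1" and i: "i \<in> Poly_Mapping.keys r" for q i
    proof -
      have "M 1 *\<^sub>v unit_vec n1 q \<in> {w \<in> free_mod V n0. M 0 *\<^sub>v w = 0\<^sub>v 1}"
        using unit[of n1 q] unfolding kernel by blast
      then have col: "(M 0 *\<^sub>v (M 1 *\<^sub>v unit_vec n1 q)) $ 0 = 0" "M 1 *\<^sub>v unit_vec n1 q \<in> carrier_vec n0"
        by (auto simp: free_mod_def)
      have "(M 1 *\<^sub>v unit_vec n1 q) $ p = N p q" if "p < n0" for p
        using q that by (subst M1v) (simp_all add: if_distrib[of "(*) _"] cong: if_cong)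
      then have syz: "(\<Sum>p<n0. N p q * f p) = 0"
        using col(1) unfolding M0v[OF col(2)] by (simp add: mult.commute)
      let ?m = "u + Poly_Mapping.single i 1"
      have i': "Poly_Mapping.lookup u i < Poly_Mapping.lookup v i"
        using i by (simp add: r_def in_keys_iff lookup_minus)
      have "0 = Poly_Mapping.lookup (\<Sum>p<n0. N p q * f p) ?m"
        by (simp add: syz)
      also have "\<dots> = (\<Sum>p<n0. \<Sum>j\<in>Poly_Mapping.keys ?m.
          ?c p q j * Poly_Mapping.lookup (f p) (?m - Poly_Mapping.single j 1))"
        unfolding lookup_sum using q by (intro sum.cong refl lookup_mult_homogeneous_1 N_hom) auto
      also have "\<dots> = (\<Sum>p<n0. \<Sum>j\<in>Poly_Mapping.keys ?m.
          if j = i then Poly_Mapping.lookup (f p) u * ?c p q i else 0)"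
      proof (intro sum.cong refl)
        fix p j assume p: "p \<in> {..<n0}" and j: "j \<in> Poly_Mapping.keys ?m"
        show "?c p q j * Poly_Mapping.lookup (f p) (?m - Poly_Mapping.single j 1) =
            (if j = i then Poly_Mapping.lookup (f p) u * ?c p q i else 0)"
        proof (cases "j = i")
          case False
          then have "0 < Poly_Mapping.lookup u j"
            using j by (simp add: in_keys_iff lookup_add lookup_single)
          then show ?thesis
            using False noex[of i j] i' f_supp p by simp
        qed simp
      qed
      also have "\<dots> = (\<Sum>p<n0. Poly_Mapping.lookup (f p) u * ?c p q i)"
        by (simp add: in_keys_iff lookup_add)
      finally show ?thesis
        by simp
    qed
    \<comment> \<open>Expand \<open>z = M 1 *\<^sub>v w\<close>. The linear entries of
      \<open>M 1\<close> split off one variable, which at the exponent \<open>r\<close> is one of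
      the keys of \<open>r\<close>; there \<open>H\<close> applies once the sums are
      swapped.\<close>
    have "(\<Sum>p<n0. Poly_Mapping.lookup (f p) u * Poly_Mapping.lookup (z $ p) r) =
        (\<Sum>p<n0. \<Sum>q<n1. \<Sum>i\<in>Poly_Mapping.keys r.
          Poly_Mapping.lookup (f p) u * ?c p q i * Poly_Mapping.lookup (w $ q) (r - Poly_Mapping.single i 1))"
    proof (intro sum.cong refl)
      fix p assume p: "p \<in> {..<n0}"
      have "Poly_Mapping.lookup (N p q * w $ q) r = (\<Sum>i\<in>Poly_Mapping.keys r.
          ?c p q i * Poly_Mapping.lookup (w $ q) (r - Poly_Mapping.single i 1))" if "q < n1" for q
        using N_hom that p by (intro lookup_mult_homogeneous_1) auto
      then show "Poly_Mapping.lookup (f p) u * Poly_Mapping.lookup (z $ p) r =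
          (\<Sum>q<n1. \<Sum>i\<in>Poly_Mapping.keys r.
          Poly_Mapping.lookup (f p) u * ?c p q i * Poly_Mapping.lookup (w $ q) (r - Poly_Mapping.single i 1))"
        using p M1v[OF w(1), of p] unfolding w(2)[symmetric]
        by (simp add: lookup_sum sum_distrib_left mult.assoc)
    qed
    also have "\<dots> = (\<Sum>q<n1. \<Sum>i\<in>Poly_Mapping.keys r. \<Sum>p<n0.
          Poly_Mapping.lookup (f p) u * ?c p q i * Poly_Mapping.lookup (w $ q) (r - Poly_Mapping.single i 1))"
      by (subst sum.swap, intro sum.cong refl sum.swap)
    also have "\<dots> = 0"
      by (rule sum.neutral, rule ballI, rule sum.neutral, rule ballI) (simp add: H[unfolded One_nat_def] flip: sum_distrib_right)
    finally show ?thesis .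
  qed
  ultimately show False
    by simp
qed

section \<open>Symbolic powers of cover ideals\<close>

text \<open>These are the \<open>k\<close>-covers of \<open>G\<close>; those supported in
  \<open>verts G\<close> are the exponent vectors of the monomials in the symbolic power.\<close>

definition sympow_exponent :: "'v ugraph \<Rightarrow> nat \<Rightarrow> ('v \<Rightarrow>\<^sub>0 nat) \<Rightarrow> bool" where
  "sympow_exponent G k m \<longleftrightarrow>
     (\<forall>x y. {x, y} \<in> edges G \<longrightarrow> k \<le> Poly_Mapping.lookup m x + Poly_Mapping.lookup m y)"

lemma sympow_exponent_add:
  assumes "sympow_exponent G k m"
  shows "sympow_exponent G k (m + n)"
  unfolding sympow_exponent_def
proof (intro allI impI)
  fix x y assume "{x, y} \<in> edges G"
  then have "k \<le> Poly_Mapping.lookup m x + Poly_Mapping.lookup m y"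
    using assms by (simp add: sympow_exponent_def)
  then show "k \<le> Poly_Mapping.lookup (m + n) x + Poly_Mapping.lookup (m + n) y"
    by (simp add: lookup_add)
qed

lemma single_in_cover_ideal_sympow:
  assumes "simple_graph G" "Poly_Mapping.keys m \<subseteq> verts G" "sympow_exponent G k m"
  shows "(Poly_Mapping.single m 1 :: ('v, 'k::field) mpol) \<in> cover_ideal_sympow G k"
  unfolding cover_ideal_sympow_def
proof (intro IntI INT_I)
  fix e assume e: "e \<in> edges G"
  obtain x y where xy: "e = {x, y}"
    using simple_graph_edgeE[OF assms(1) e] .
  then show "(Poly_Mapping.single m 1 :: ('v, 'k) mpol) \<in>
      (Idl\<^bsub>mpoly_ring (verts G)\<^esub> (var ` e)) [^]\<^bsub>ideals_set (mpoly_ring (verts G))\<^esub> k"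
    using simple_graph_edgeD[OF assms(1), of x y] e assms(2,3) unfolding xy
    by (intro single_in_edge_ideal_pow) (auto simp: sympow_exponent_def)
qed (simp add: single_in_carrier_iff assms)

lemma cover_ideal_sympow_exponents:
  fixes p :: "('v, 'k::field) mpol"
  assumes "simple_graph G" "p \<in> cover_ideal_sympow G k" "m \<in> Poly_Mapping.keys p"
  shows "sympow_exponent G k m"
  unfolding sympow_exponent_def
proof (intro allI impI)
  fix x y assume xy: "{x, y} \<in> edges G"
  have "p \<in> (Idl\<^bsub>mpoly_ring (verts G)\<^esub> (var ` {x, y})) [^]\<^bsub>ideals_set (mpoly_ring (verts G))\<^esub> k"
    using assms(2) xy unfolding cover_ideal_sympow_def by blast
  then show "k \<le> Poly_Mapping.lookup m x + Poly_Mapping.lookup m y"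
    using assms(3) by (rule edge_ideal_pow_subset(2)[OF simple_graph_edgeD(1,2)[OF assms(1) xy], rule_format])
qed

text \<open>The exchange property is applied to the component in degree \<open>mdeg u\<close>.
  Having degree at least \<open>mdeg u\<close> and being a \<open>k\<close>-cover are upward closed
  conditions, so they hold for all monomials of the ideal generated by that component.\<close>

lemma componentwise_linear_exchange:
  fixes G :: "'v ugraph"
  assumes sg: "simple_graph G"
    and lin: "componentwise_linear (verts G) (cover_ideal_sympow G k :: ('v, 'k::field) mpol set)"
    and u: "Poly_Mapping.keys u \<subseteq> verts G" "sympow_exponent G k u"
    and v: "Poly_Mapping.keys v \<subseteq> verts G" "sympow_exponent G k v"
    and "mdeg u = mdeg v" "u \<noteq> v"
  shows "\<exists>i j. i \<noteq> j \<and> Poly_Mapping.lookup u i < Poly_Mapping.lookup v i \<and>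
    0 < Poly_Mapping.lookup u j \<and>
    sympow_exponent G k (u + Poly_Mapping.single i 1 - Poly_Mapping.single j 1)"
proof -
  let ?R = "mpoly_ring (verts G) :: ('v, 'k) mpol ring"
  let ?D = "{p \<in> cover_ideal_sympow G k. homogeneous (mdeg u) p} :: ('v, 'k) mpol set"
  let ?Q = "\<lambda>m. mdeg u \<le> mdeg m \<and> sympow_exponent G k m"
  interpret cring ?R
    by (rule cring_mpoly_ring)
  have D: "?D \<subseteq> carrier ?R"
    by (auto simp: cover_ideal_sympow_def)
  have "ideal {p \<in> carrier ?R. \<forall>m\<in>Poly_Mapping.keys p. ?Q m} ?R"
    by (rule ideal_upset) (auto simp: mdeg_add sympow_exponent_add)
  moreover have "?D \<subseteq> {p \<in> carrier ?R. \<forall>m\<in>Poly_Mapping.keys p. ?Q m}"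
    using D cover_ideal_sympow_exponents[OF sg] by (auto simp: homogeneous_def)
  ultimately have K: "Idl\<^bsub>?R\<^esub> ?D \<subseteq> {p \<in> carrier ?R. \<forall>m\<in>Poly_Mapping.keys p. ?Q m}"
    by (rule genideal_minimal)
  have single: "Poly_Mapping.single m 1 \<in> Idl\<^bsub>?R\<^esub> ?D"
    if "Poly_Mapping.keys m \<subseteq> verts G" "sympow_exponent G k m" "mdeg m = mdeg u" for m
    using that single_in_cover_ideal_sympow[OF sg that(1,2)] genideal_self[OF D]
    by (auto simp: homogeneous_def)
  show ?thesis
  proof (rule linear_resolution_exchange)
    show "has_linear_resolution (verts G) (Idl\<^bsub>?R\<^esub> ?D)"
      using lin by (simp add: componentwise_linear_def)
  qed (use K single assms in auto)
qed

lemma lookup_eq_exists: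
  fixes f :: "'v \<Rightarrow> nat"
  assumes "finite S" "\<And>x. x \<notin> S \<Longrightarrow> f x = 0"
  obtains m where "Poly_Mapping.lookup m = f" "Poly_Mapping.keys m \<subseteq> S"
proof -
  have "{x. f x \<noteq> 0} \<subseteq> S"
    using assms(2) by (metis (mono_tags) mem_Collect_eq subsetI)
  then have "finite {x. f x \<noteq> 0}"
    using assms(1) finite_subset by blast
  then have "Poly_Mapping.lookup (Abs_poly_mapping f) = f"
    by simp
  then show ?thesis
    using that assms(2) by (metis in_keys_iff subsetI)
qed

text \<open>The exponents \<open>e W\<close> embed the vertex covers \<open>W\<close> of \<open>B_H\<close>, where \<open>H = G \<setminus> N[A]\<close>, into those of
  the symbolic power: an edge between two vertices of the shedding order imposes no condition since
  \<open>2 (k - 1) \<ge> k\<close>. The vertices of \<open>H\<close> outside the core \<open>D = B_H \<setminus> N[C]\<close> are frozen.\<close>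

lemma not_componentwise_linear_of_min_degree_ge_2:
  fixes G :: "'v ugraph" and as :: "'v list"
  defines "S \<equiv> set as"
  assumes sg: "simple_graph G" and A: "indep_set G A" and k: "2 \<le> k"
    and H: "H = del_verts G (closed_nbhd G A)" and as: "shedding_order H as"
    and B: "B = bip_graph H as" and C: "indep_set B C"
    and D: "D = verts B - closed_nbhd B C" "D \<noteq> {}"
    and deg: "\<And>x i. x \<in> D \<Longrightarrow> \<exists>p. p \<in> D \<and> p \<noteq> i \<and> {x, p} \<in> edges B"
  shows "\<not> componentwise_linear (verts G) (cover_ideal_sympow G k :: ('v, 'k::field) mpol set)"
proof
  assume lin: "componentwise_linear (verts G) (cover_ideal_sympow G k :: ('v, 'k) mpol set)"
  have fin: "finite (verts G)"
    using sg by (simp add: simple_graph_def)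
  have sgH: "simple_graph H" and sgB: "simple_graph B"
    using sg unfolding H B by (blast intro: simple_graph_del_verts simple_graph_bip_graph)+
  have vB: "verts B = verts H" and vH: "verts H = verts G - nbhd G A - A"
    by (auto simp: B bip_graph_def H closed_nbhd_def)
  have edge_sym: "{x, y} \<in> edges K \<longleftrightarrow> {y, x} \<in> edges K" for x y and K :: "'v ugraph"
    by (simp add: insert_commute)
  have B_H: "{x, y} \<in> edges H" "(x \<in> S) \<noteq> (y \<in> S)" if "{x, y} \<in> edges B" for x y
    using that by (auto simp: B bip_graph_def S_def doubleton_eq_iff insert_commute)
  have H_B: "{x, y} \<in> edges B" if xy: "{x, y} \<in> edges H" "(x \<in> S) \<noteq> (y \<in> S)" for x y
  proof -
    have "{b, a} \<in> edges B" if "{b, a} \<in> edges H" "b \<notin> S" "a \<in> S" for a b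
      using that simple_graph_edgeD(1)[OF sgH that(1)] unfolding B bip_graph_def S_def by auto
    then show ?thesis
      using xy edge_sym by metis
  qed
  have H_G: "{x, y} \<in> edges G" if "{x, y} \<in> edges H" for x y
    using that by (simp add: H)
  have H_S: "x \<in> S \<or> y \<in> S" if xy: "{x, y} \<in> edges H" for x y
  proof (rule ccontr)
    assume "\<not> ?thesis"
    then have "{x, y} \<in> edges (del_verts H S)"
      using xy by simp
    moreover have "edges (del_verts H S) = {}"
      using as by (simp add: shedding_order_def S_def)
    ultimately show False
      by blast
  qed
  define Q where "Q = nbhd B C"
  have QB: "Q \<subseteq> verts B" and CB: "C \<subseteq> verts B"
    using C by (auto simp: Q_def nbhd_def indep_set_def)
  have cover: "verts B = C \<union> Q \<union> D"
    using CB QB by (auto simp: D(1) closed_nbhd_def Q_def)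
  have disj: "C \<inter> Q = {}" "D \<inter> (C \<union> Q) = {}"
    using C by (auto simp: Q_def nbhd_def D(1) closed_nbhd_def indep_set_iff[OF sgB])
  have Q_iff: "x \<in> Q \<longleftrightarrow> (\<exists>c\<in>C. {x, c} \<in> edges B)" for x
    using simple_graph_edgeD[OF sgB] by (auto simp: Q_def nbhd_def edge_sym[of x])
  \<comment> \<open>Neighbours of \<open>A\<close> get \<open>k\<close>, which settles every edge at
    them, and \<open>A\<close> gets 0. Inside \<open>H\<close> the base value is
    \<open>k - 1\<close> on the shedding order and 0 on the i-order; membership in \<open>W\<close>
    adds 1.\<close>
  define e where "e W x = (if x \<in> nbhd G A then k else
      if x \<in> verts H then (if x \<in> S then k - 1 else 0) + (if x \<in> W then 1 else 0) else 0)" for W x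
  \<comment> \<open>Exactly one end of an edge of \<open>B\<close> is in the shedding order, so the
    sum reaches \<open>k\<close> precisely when \<open>W\<close> meets the edge.\<close>
  have e_sum: "e W x + e W y = k - 1 + (if x \<in> W then 1 else 0) + (if y \<in> W then 1 else 0)"
    if "{x, y} \<in> edges B" for W x y
    using B_H[OF that] simple_graph_edgeD[OF sgB that] by (auto simp: e_def vB vH)
  have e_cover: "k \<le> e W x + e W y"
    if W: "\<And>x y. {x, y} \<in> edges B \<Longrightarrow> x \<in> W \<or> y \<in> W" and xy: "{x, y} \<in> edges G" for W x y
  proof (cases "x \<in> nbhd G A \<or> y \<in> nbhd G A")
    case True
    then show ?thesis
      by (auto simp: e_def)
  next
    case False
    \<comment> \<open>All neighbours of \<open>A\<close> are in \<open>nbhd G A\<close>, so the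
      remaining edges lie in \<open>H\<close>.\<close>
    then have "x \<notin> A" "y \<notin> A"
      using xy simple_graph_edgeD[OF sg xy] by (auto simp: nbhd_def edge_sym[of x])
    then have xyH: "{x, y} \<in> edges H"
      using xy False by (auto simp: H closed_nbhd_def)
    show ?thesis
    proof (cases "x \<in> S \<and> y \<in> S")
      case True
      then show ?thesis
        using simple_graph_edgeD[OF sgH xyH] False k by (simp add: e_def)
    next
      case False
      then have xyB: "{x, y} \<in> edges B"
        using H_S[OF xyH] by (intro H_B[OF xyH]) blast
      then show ?thesis
        using W[OF xyB] k by (auto simp: e_sum)
    qed
  qed
  have step: False
    if LR: "D = L \<union> R" "L \<inter> R = {}" "card L \<le> card R"
      and L: "\<And>x y. x \<in> L \<Longrightarrow> y \<in> L \<Longrightarrow> {x, y} \<notin> edges B"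
      and R: "\<And>x y. x \<in> R \<Longrightarrow> y \<in> R \<Longrightarrow> {x, y} \<notin> edges B" for L R
  proof -
    have bip: "x \<in> L \<and> y \<in> R \<or> x \<in> R \<and> y \<in> L" if "x \<in> D" "y \<in> D" "{x, y} \<in> edges B" for x y
      using that LR(1) L R by blast
    obtain l0 where l0: "l0 \<in> L"
      using D(2) deg bip by (metis all_not_in_conv)
    obtain r0 where r0: "r0 \<in> R"
      using D(2) deg bip by (metis all_not_in_conv)
    have subG: "D \<subseteq> verts H" "L \<subseteq> verts H" "R \<subseteq> verts H" "Q \<subseteq> verts H"
      using QB LR(1) by (auto simp: D(1) vB)
    \<comment> \<open>Edges at \<open>C\<close> end in \<open>Q\<close>, and edges inside the core
      join \<open>L\<close> to \<open>R\<close>, so adding either side to \<open>Q\<close> gives a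
      vertex cover of \<open>B\<close>.\<close>
    have Wcov: "x \<in> Q \<union> W \<or> y \<in> Q \<union> W"
      if W: "W = L \<or> W = R" and xy: "{x, y} \<in> edges B" for W x y
    proof (rule ccontr)
      assume n: "\<not> ?thesis"
      then have "x \<notin> C" "y \<notin> C"
        using xy Q_iff edge_sym[of x y B] by auto
      then have "x \<in> D" "y \<in> D"
        using n simple_graph_edgeD[OF sgB xy] cover by auto
      then show False
        using bip xy W n by blast
    qed
    \<comment> \<open>\<open>?d\<close> equalises the degrees. It is added at a vertex of
      \<open>L\<close>, so that \<open>v\<close> exceeds \<open>u\<close> only inside
      \<open>L\<close>.\<close>
    let ?d = "card R - card L"
    let ?eu = "e (Q \<union> R)" and ?ev = "\<lambda>x. e (Q \<union> L) x + (if x = l0 then ?d else 0)"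
    have supp: "?eu x = 0" "?ev x = 0" if "x \<notin> verts G" for x
      using that l0 subG by (auto simp: e_def vH nbhd_def)
    obtain u where u: "Poly_Mapping.lookup u = ?eu" "Poly_Mapping.keys u \<subseteq> verts G"
      using lookup_eq_exists[OF fin, of ?eu] supp by blast
    obtain v where v: "Poly_Mapping.lookup v = ?ev" "Poly_Mapping.keys v \<subseteq> verts G"
      using lookup_eq_exists[OF fin, of ?ev] supp by blast
    have sum_e: "(\<Sum>x\<in>verts G. e (Q \<union> W) x) = (\<Sum>x\<in>verts G. e {} x) + card Q + card W"
      if W: "W = L \<or> W = R" for W
    proof -
      have QW: "Q \<union> W \<subseteq> verts H" "Q \<inter> W = {}" "Q \<union> W \<subseteq> verts G"
        using W subG disj LR(1) by (auto simp: vH)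
      have "e (Q \<union> W) x = e {} x + (if x \<in> Q \<union> W then 1 else 0)" for x
        using QW(1) by (auto simp: e_def vH)
      then have "(\<Sum>x\<in>verts G. e (Q \<union> W) x) =
          (\<Sum>x\<in>verts G. e {} x) + (\<Sum>x\<in>verts G. if x \<in> Q \<union> W then 1 else 0)"
        by (simp add: sum.distrib)
      also have "(\<Sum>x\<in>verts G. if x \<in> Q \<union> W then 1 else 0) = (\<Sum>x\<in>verts G \<inter> (Q \<union> W). 1)"
        by (rule sum.inter_restrict[OF fin, symmetric])
      also have "\<dots> = card (Q \<union> W)"
        unfolding Int_absorb1[OF QW(3)] by simp
      also have "\<dots> = card Q + card W"
        using fin QW by (intro card_Un_disjoint) (auto intro: finite_subset)
      finally show ?thesis
        by simp
    qed
    have "l0 \<in> verts G"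
      using l0 subG vH by blast
    then have "mdeg u = mdeg v"
      using LR(3) fin
      by (simp add: mdeg_eq_sum[OF fin u(2)] mdeg_eq_sum[OF fin v(2)] u(1) v(1) sum.distrib sum_e)
    moreover have "u \<noteq> v"
    proof
      assume "u = v"
      then have "?eu r0 = ?ev r0"
        using u(1) v(1) by metis
      moreover have "r0 \<notin> L" "r0 \<notin> Q" "r0 \<notin> nbhd G A" "r0 \<in> verts H" "r0 \<noteq> l0"
        using r0 LR disj subG l0 vH by auto
      ultimately show False
        using r0 by (simp add: e_def)
    qed
    moreover have "sympow_exponent G k u" "sympow_exponent G k v"
    proof -
      show "sympow_exponent G k u"
        unfolding sympow_exponent_def u(1) using e_cover[OF Wcov[of R]] by blast
      have "k \<le> ?ev x + ?ev y" if xy: "{x, y} \<in> edges G" for x y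
      proof -
        have "k \<le> e (Q \<union> L) x + e (Q \<union> L) y"
          using e_cover[OF Wcov[of L] xy] by blast
        then show ?thesis
          by auto
      qed
      then show "sympow_exponent G k v"
        unfolding sympow_exponent_def v(1) by blast
    qed
    ultimately obtain i j where ij: "i \<noteq> j" "?eu i < ?ev i" "0 < ?eu j"
      "sympow_exponent G k (u + Poly_Mapping.single i 1 - Poly_Mapping.single j 1)"
      using componentwise_linear_exchange[OF sg lin u(2) _ v(2)] unfolding u(1) v(1) by blast
    have i: "i \<in> L"
    proof (rule ccontr)
      assume "i \<notin> L"
      then show False
        using ij(2) l0 by (auto simp: e_def split: if_splits)
    qed
    have iD: "i \<in> D" "i \<in> verts H"
      using i LR(1) subG by auto
    \<comment> \<open>Every \<open>j\<close> with positive exponent lies on an edge that avoids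
      \<open>i\<close> and has exponent sum at most \<open>k\<close>; lowering the exponent of
      \<open>j\<close> violates this edge.\<close>
    have "\<exists>p. p \<noteq> i \<and> {j, p} \<in> edges G \<and> ?eu j + ?eu p \<le> k"
    proof (cases "j \<in> nbhd G A")
      case True
      then obtain p where p: "p \<in> A" "{j, p} \<in> edges G"
        by (auto simp: nbhd_def edge_sym[of j])
      have "p \<notin> nbhd G A"
        using A p(1) by (auto simp: nbhd_def indep_set_iff[OF sg])
      then have "?eu p = 0"
        using p(1) by (simp add: e_def vH)
      moreover have "p \<noteq> i"
        using p(1) iD vH by blast
      ultimately show ?thesis
        using p True by (intro exI[of _ p]) (simp add: e_def)
    next
      case False
      then have jH: "j \<in> verts H"
        using ij(3) by (auto simp: e_def split: if_splits)
      \<comment> \<open>By \<open>e_sum\<close> an edge of \<open>B\<close> with at most one end in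
        the cover has sum at most \<open>k\<close>. For \<open>j\<close> in the core the minimum
        degree supplies such an edge away from \<open>i\<close>.\<close>
      have "\<exists>p. p \<noteq> i \<and> {j, p} \<in> edges B \<and> (j \<notin> Q \<union> R \<or> p \<notin> Q \<union> R)"
      proof -
        consider "j \<in> Q" | "j \<in> R" | "j \<in> L" | "j \<in> C"
          using jH cover LR(1) unfolding vB by blast
        then show ?thesis
        proof cases
          case 1
          then obtain p where p: "p \<in> C" "{j, p} \<in> edges B"
            using Q_iff by blast
          then have "p \<noteq> i" "p \<notin> Q \<union> R"
            using disj LR(1) iD(1) by auto
          then show ?thesis
            using p(2) by (intro exI[of _ p]) simp
        next
          case 2
          then obtain p where p: "p \<in> D" "p \<noteq> i" "{j, p} \<in> edges B"
            using deg[of j i] LR(1) by blast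
          then have "p \<in> L"
            using bip[of j p] 2 LR(1,2) by auto
          then have "p \<notin> Q \<union> R"
            using disj LR(1,2) by auto
          then show ?thesis
            using p(2,3) by (intro exI[of _ p]) simp
        next
          case 3
          then obtain p where p: "p \<noteq> i" "{j, p} \<in> edges B"
            using deg[of j i] LR(1) by blast
          have "j \<notin> Q \<union> R"
            using 3 disj LR(1,2) by auto
          then show ?thesis
            using p by (intro exI[of _ p]) simp
        next
          case 4
          \<comment> \<open>Outside the cover the exponent is 0 on the i-order, so positivity puts
            \<open>j\<close> in the shedding order. Its neighbour in the i-order then lies in
            \<open>Q\<close> and differs from \<open>i\<close>.\<close>
          then have jS: "j \<in> S"
            using ij(3) False disj LR(1) by (auto simp: e_def split: if_splits)
          obtain p where p: "p \<in> verts H - S" "{p, j} \<in> edges H"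
            using shedding_order_neighbour[OF sgH as] jS unfolding S_def by blast
          then have pB: "{j, p} \<in> edges B"
            using jS by (intro H_B) (auto simp: edge_sym[of j])
          then have "p \<in> Q"
            using 4 Q_iff edge_sym[of j p B] by blast
          then have "p \<noteq> i" "j \<notin> Q \<union> R"
            using iD(1) disj 4 LR(1) by auto
          then show ?thesis
            using pB by (intro exI[of _ p]) simp
        qed
      qed
      then obtain p where p: "p \<noteq> i" "{j, p} \<in> edges B" "j \<notin> Q \<union> R \<or> p \<notin> Q \<union> R"
        by blast
      then have "?eu j + ?eu p \<le> k"
        using k by (subst e_sum) auto
      then show ?thesis
        using p B_H H_G by blast
    qed
    then obtain p where p: "p \<noteq> i" "{j, p} \<in> edges G" "?eu j + ?eu p \<le> k"
      by blast
    have "j \<noteq> p"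
      using simple_graph_edgeD(3)[OF sg p(2)] .
    then have "Poly_Mapping.lookup (u + Poly_Mapping.single i 1 - Poly_Mapping.single j 1) j +
        Poly_Mapping.lookup (u + Poly_Mapping.single i 1 - Poly_Mapping.single j 1) p < k"
      using p(1,3) ij(1,3) by (simp add: lookup_minus lookup_add lookup_single u(1))
    then show False
      using ij(4) p(2) unfolding sympow_exponent_def by (meson not_le)
  qed
  have "x \<in> S \<Longrightarrow> y \<in> S \<Longrightarrow> {x, y} \<notin> edges B" "x \<notin> S \<Longrightarrow> y \<notin> S \<Longrightarrow> {x, y} \<notin> edges B" for x y
    using B_H by blast+
  \<comment> \<open>The shedding order splits the core into its two sides; a side with at most as
    many vertices as the other plays the role of \<open>L\<close>.\<close>
  then show False
    using step[of "D - S" "D \<inter> S"] step[of "D \<inter> S" "D - S"]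
    by (cases "card (D - S) \<le> card (D \<inter> S)") auto
qed

theorem theorem3p7:
  fixes G :: "'v ugraph"
    and sh_ord :: "'v ugraph \<Rightarrow> 'v list"
  assumes "simple_graph G"
    and "vertex_decomposable G"
    and "\<And>H. simple_graph H \<Longrightarrow> vertex_decomposable H \<Longrightarrow> shedding_order H (sh_ord H)"
    and "\<exists>A. indep_set G A \<and>
           \<not> vertex_decomposable
               (bip_graph (del_verts G (closed_nbhd G A)) (sh_ord (del_verts G (closed_nbhd G A))))"
  shows "\<forall>k\<ge>2. \<not> componentwise_linear (verts G)
                   (cover_ideal_sympow G k :: ('v, 'k::field) mpol set)"
proof (intro allI impI)
  fix k :: nat assume k: "2 \<le> k"
  obtain A where A: "indep_set G A" and nvd: "\<not> vertex_decomposable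
      (bip_graph (del_verts G (closed_nbhd G A)) (sh_ord (del_verts G (closed_nbhd G A))))"
    using assms(4) by blast
  define H where "H = del_verts G (closed_nbhd G A)"
  define B where "B = bip_graph H (sh_ord H)"
  have sgH: "simple_graph H"
    unfolding H_def by (rule simple_graph_del_verts[OF assms(1)])
  \<comment> \<open>\<open>H\<close> is again vertex decomposable, so the order fixed for it is a
    shedding order.\<close>
  have order: "shedding_order H (sh_ord H)"
    using vertex_decomposable_del_closed_nbhd[OF assms(2,1) A] sgH
    by (intro assms(3)) (simp_all add: H_def)
  have "simple_graph B" "\<not> vertex_decomposable B"
    using nvd simple_graph_bip_graph[OF sgH] by (simp_all add: B_def H_def)
  then obtain C where "indep_set B C" "verts B - closed_nbhd B C \<noteq> {}"
    "\<And>x i. x \<in> verts B - closed_nbhd B C \<Longrightarrow>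
       \<exists>p. p \<in> verts B - closed_nbhd B C \<and> p \<noteq> i \<and> {x, p} \<in> edges B"
    using not_vertex_decomposable_min_degree_ge_2 by metis
  then show "\<not> componentwise_linear (verts G) (cover_ideal_sympow G k :: ('v, 'k) mpol set)"
    by (intro not_componentwise_linear_of_min_degree_ge_2[OF assms(1) A k H_def order B_def _ refl])
qed

end
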